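(* Let $\widehat{C}$ be the strict quadratic transform of a reduced singular unitangent curve $C$. Then: (i) if $d(C)<2$, then $m(\widehat{C})<m(C)$; (ii) if $d(C)\ge 2$, then $m(\widehat{C})=m(C)$ and $d(\widehat{C})=d(C)-1$; (iii) if $d(C)\ge 2$ and $W$ is a smooth curve tangent to $C$, then $d(C,W)=d(\widehat{C},\widehat{W})+1$. If (moreover) $W$ has maximal contact with $C$, then $\widehat{W}$ has maximal contact with $\widehat{C}$.
   Context: $K$ is an algebraically closed field of arbitrary characteristic. An algebroid curve $C:\{f=0\}$ is the ideal of $K[[x,y]]$ generated by a nonzero power series $f$ without constant term; its multiplicity is $m(C)=\mathrm{ord}\, f$, and $C$ is singular if $m(C)>1$, smooth if $m(C)=1$. $C$ is reduced if $f$ has no multiple factors; $C$ is a branch if $f$ is irreducible. The branches of a reduced curve $C:\{f=0\}$ are the curves defined by the irreducible factors of $f$. The tangent cone of $C$ is $\mathrm{cone}(C)=\{(a:b)\in\mathbb{P}^1(K): (\mathrm{in} f)(a,b)=0\}$, where $\mathrm{in} f$ is the initial form of $f$. $C$ is unitangent if $\mathrm{cone}(C)$ has exactly one point. A smooth curve $W$ is tangent to a unitangent curve $C$ if they have the same tangent cone. Strict quadratic transform: let $C:\{f=0\}$ be a reduced unitangent curve of multiplicity $n$. Either (a) $f=c(y-ax)^n+$ higher order terms with $a,c\in K$, $c\ne0$, and then $f_1(x_1,y_1)=x_1^{-n}f(x_1,ax_1+x_1y_1)$; or (b) $f=cx^n+$ higher order terms with $c\in K\setminus\{0\}$, and then $f_1(x_1,y_1)=y_1^{-n}f(x_1y_1,y_1)$.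 The strict quadratic transform of $C$ is $\widehat{C}:\{f_1=0\}$, an algebroid curve in $K[[x_1,y_1]]$. For curves $C:\{f=0\}$, $D:\{g=0\}$ put $(C,D)_0=\dim_K K[[x,y]]/(f,g)$ (possibly $+\infty$). For branches $C,D$ put $d(C,D)=\frac{(C,D)_0}{m(C)m(D)}$; for reduced curves $C,D$ with branches $C_i,D_j$ put $d(C,D)=\inf_{i,j}\{d(C_i,D_j)\}$. The contact exponent of a reduced curve $C$ is $d(C):=\sup\{d(C,W): W \text{ a smooth branch}\}$. A smooth branch $W$ has maximal contact with $C$ if $d(C,W)=d(C)$. (The same definitions are used in $K[[x_1,y_1]]$.) *)

theory Defs
  imports
    "HOL-Computational_Algebra.Computational_Algebra"
    "HOL-Library.Extended_Real"
begin

text \<open>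
  The ring $K[[x,y]]$ is represented as $K[[x]][[y]]$: for \<open>f :: 'k fps fps\<close> the coefficient of
  $x^i y^j$ is \<open>f $ j $ i\<close>.  A curve is given by a defining power series; all the invariants below
  depend only on the ideal generated by that series.
\<close>

type_synonym 'k fps2 = "'k fps fps"

definition coeff2 :: "'k::zero fps2 \<Rightarrow> nat \<Rightarrow> nat \<Rightarrow> 'k" where
  "coeff2 f i j = f $ j $ i"

definition const2 :: "'k::zero \<Rightarrow> 'k fps2" where
  "const2 c = fps_const (fps_const c)"

definition varX :: "'k::comm_ring_1 fps2" where
  "varX = fps_const fps_X"

definition varY :: "'k::comm_ring_1 fps2" where
  "varY = fps_X"

definition has_no_const :: "'k::zero fps2 \<Rightarrow> bool" where
  "has_no_const f \<longleftrightarrow> coeff2 f 0 0 = 0"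

text \<open>
  Substitution $f(u,v) = \sum_{i,j} f_{ij} u^i v^j$, meaningful for \<open>u\<close>, \<open>v\<close> without constant term.
  In that case $u^i v^j$ has order at least $i+j$, so only the terms with $i, j \le k+l$ contribute
  to the coefficient of $x^k y^l$.
\<close>

definition subst2 :: "'k::comm_ring_1 fps2 \<Rightarrow> 'k fps2 \<Rightarrow> 'k fps2 \<Rightarrow> 'k fps2" where
  "subst2 f u v = Abs_fps (\<lambda>l. Abs_fps (\<lambda>k.
     \<Sum>i\<le>k+l. \<Sum>j\<le>k+l. coeff2 f i j * coeff2 (u ^ i * v ^ j) k l))"

definition ord2 :: "'k::zero fps2 \<Rightarrow> nat" where
  "ord2 f = (LEAST n. \<exists>i j. i + j = n \<and> coeff2 f i j \<noteq> 0)"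

definition initial_form :: "'k::zero fps2 \<Rightarrow> 'k fps2" where
  "initial_form f = Abs_fps (\<lambda>j. Abs_fps (\<lambda>i. if i + j = ord2 f then coeff2 f i j else 0))"

definition initial_form_at :: "'k::comm_ring_1 fps2 \<Rightarrow> 'k \<Rightarrow> 'k \<Rightarrow> 'k" where
  "initial_form_at f a b =
     (\<Sum>i\<le>ord2 f. coeff2 (initial_form f) i (ord2 f - i) * a ^ i * b ^ (ord2 f - i))"

definition algebroid_curve :: "'k::zero fps2 \<Rightarrow> bool" where
  "algebroid_curve f \<longleftrightarrow> f \<noteq> 0 \<and> has_no_const f"

definition curve_mult :: "'k::zero fps2 \<Rightarrow> nat" where
  "curve_mult f = ord2 f"

definition singular_curve :: "'k::zero fps2 \<Rightarrow> bool" where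
  "singular_curve f \<longleftrightarrow> algebroid_curve f \<and> curve_mult f > 1"

definition smooth_curve :: "'k::zero fps2 \<Rightarrow> bool" where
  "smooth_curve f \<longleftrightarrow> algebroid_curve f \<and> curve_mult f = 1"

definition reduced_curve :: "'k::field fps2 \<Rightarrow> bool" where
  "reduced_curve f \<longleftrightarrow> algebroid_curve f \<and> squarefree f"

definition branch :: "'k::field fps2 \<Rightarrow> bool" where
  "branch f \<longleftrightarrow> algebroid_curve f \<and> irreducible f"

text \<open>
  All equations of all branches of \<open>f\<close>; associated irreducible factors define the same branch.
\<close>

definition branches :: "'k::field fps2 \<Rightarrow> 'k fps2 set" where
  "branches f = {g. branch g \<and> g dvd f}"

text \<open>
  The point $(a:b)$ of the projective line, for $(a,b) \ne (0,0)$, as the set of its homogeneous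
  coordinates.
\<close>

definition proj_point :: "'k::field \<Rightarrow> 'k \<Rightarrow> ('k \<times> 'k) set" where
  "proj_point a b = {(t * a, t * b) | t. t \<noteq> 0}"

definition tangent_cone :: "'k::field fps2 \<Rightarrow> ('k \<times> 'k) set set" where
  "tangent_cone f = {proj_point a b | a b. (a, b) \<noteq> (0, 0) \<and> initial_form_at f a b = 0}"

definition unitangent :: "'k::field fps2 \<Rightarrow> bool" where
  "unitangent f \<longleftrightarrow> (\<exists>!P. P \<in> tangent_cone f)"

definition tangent_to :: "'k::field fps2 \<Rightarrow> 'k fps2 \<Rightarrow> bool" where
  "tangent_to w f \<longleftrightarrow> smooth_curve w \<and> unitangent f \<and> tangent_cone w = tangent_cone f"

text \<open>
  For a unitangent curve \<open>f\<close> of multiplicity $n$ exactly one of the two cases applies, and in the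
  first one \<open>a\<close> is determined by \<open>f\<close>.  The factors $x_1^{-n}$ and $y_1^{-n}$ are moved to the left.
\<close>

definition is_strict_transform :: "'k::field fps2 \<Rightarrow> 'k fps2 \<Rightarrow> bool" where
  "is_strict_transform f f1 \<longleftrightarrow>
     (\<exists>a c. c \<noteq> 0 \<and> initial_form f = const2 c * (varY - const2 a * varX) ^ curve_mult f \<and>
        varX ^ curve_mult f * f1 = subst2 f varX (const2 a * varX + varX * varY)) \<or>
     (\<exists>c. c \<noteq> 0 \<and> initial_form f = const2 c * varX ^ curve_mult f \<and>
        varY ^ curve_mult f * f1 = subst2 f (varX * varY) varY)"

definition strict_transform :: "'k::field fps2 \<Rightarrow> 'k fps2" where
  "strict_transform f = (THE f1. is_strict_transform f f1)"

definition ideal2 :: "'k::field fps2 \<Rightarrow> 'k fps2 \<Rightarrow> 'k fps2 set" where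
  "ideal2 f g = {p * f + q * g | p q. True}"

text \<open>
  The residue classes of the elements of the finite set \<open>B\<close> are pairwise distinct and form a
  $K$-basis of $K[[x,y]]/I$.
\<close>

definition quotient_basis :: "'k::field fps2 set \<Rightarrow> 'k fps2 set \<Rightarrow> bool" where
  "quotient_basis I B \<longleftrightarrow> finite B \<and>
     (\<forall>c. (\<Sum>b\<in>B. const2 (c b) * b) \<in> I \<longrightarrow> (\<forall>b\<in>B. c b = 0)) \<and>
     (\<forall>h. \<exists>c. h - (\<Sum>b\<in>B. const2 (c b) * b) \<in> I)"

text \<open>
  All finite bases have the same number of elements; if there is none, the infimum is \<open>\<infinity>\<close>.
\<close>

definition quotient_dim :: "'k::field fps2 set \<Rightarrow> enat" where
  "quotient_dim I = (INF B\<in>{B. quotient_basis I B}. enat (card B))"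

definition intersection_mult :: "'k::field fps2 \<Rightarrow> 'k fps2 \<Rightarrow> enat" where
  "intersection_mult f g = quotient_dim (ideal2 f g)"

definition branch_contact :: "'k::field fps2 \<Rightarrow> 'k fps2 \<Rightarrow> ereal" where
  "branch_contact f g =
     ereal_of_enat (intersection_mult f g) / ereal (real (curve_mult f * curve_mult g))"

definition contact :: "'k::field fps2 \<Rightarrow> 'k fps2 \<Rightarrow> ereal" where
  "contact f g = (INF (p, q) \<in> branches f \<times> branches g. branch_contact p q)"

definition contact_exponent :: "'k::field fps2 \<Rightarrow> ereal" where
  "contact_exponent f = (SUP w \<in> {w. branch w \<and> smooth_curve w}. contact f w)"

definition maximal_contact :: "'k::field fps2 \<Rightarrow> 'k fps2 \<Rightarrow> bool" where
  "maximal_contact w f \<longleftrightarrow> branch w \<and> smooth_curve w \<and> contact f w = contact_exponent f"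

end

theory Submission
  imports Defs
begin

text \<open>
  Contact with a smooth curve can be computed in one variable. Unless it is tangent to $x = 0$, a
  smooth curve is given, up to a unit, by $y = \<phi>(x)$, and the multiplicity of its intersection
  with $p$ is the order of $p(x, \<phi>(x))$ (\<open>intersection_mult_graph\<close>).

  Linear changes of coordinates preserve all invariants, so one may assume that the initial form
  of $f$ is $c y^n$ (\<open>horizontal\<close>). The strict transform is then $x^{-n} f(x, x y)$, and
  $y = x \<psi>(x)$ becomes $y = \<psi>(x)$. Inserting this in the definitions gives Noether's
  formula: for a branch $p$ of $f$ and a smooth curve $w$ tangent to $f$, with transforms $p'$
  and $w'$, one has $(p, w) = m(p) + (p', w')$ (\<open>Noether_formula\<close>). The branches of
  the transform of $f$ are exactly the transforms of the branches of $f$. The reason is that every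
  factor of a transform lifts to a factor of the original series, a consequence of the Weierstrass
  theorems (\<open>lift_factor_of_transform\<close>).

  If every branch $p$ keeps its multiplicity, then division of Noether's formula by $m(p)$ shows
  that the contact with smooth curves tangent to $f$ drops by exactly $1$. The other smooth curves
  do not matter for the contact exponent (\<open>contact_exponent_transform\<close>). It remains to see that
  the multiplicity of $f$ is preserved exactly when the contact exponent is at least $2$:

  \<^item> If it is preserved, then it is preserved for all branches, and a contact at least $1$ of
    the transform with the $x$-axis comes from a contact at least $2$ of $f$ with the $x$-axis.

  \<^item> Contacts with $f$ that are less than $2$ are at most $2 - 1/n$, so if the contact exponent
    is at least $2$, some smooth curve $w$ has contact at least $2$ with $f$
    (\<open>contact_ge_2_attained\<close>). Then $(p', w') \<ge> m(p)$ for each branch $p$, whereas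
    $p'$ meets the exceptional curve $x = 0$ with multiplicity $m(p)$. If $m(p') < m(p)$, then
    the branch $p'$ would have both of these transversal curves as tangents, but a branch has only
    one tangent (\<open>irreducible_initial_form_not_split\<close>).
\<close>

section \<open>Power series in two variables\<close>

lemma nth_nth_mult:
  fixes f g :: "'k::comm_ring_1 fps2"
  shows "(f * g) $ l $ k = (\<Sum>j=0..l. \<Sum>i=0..k. f $ j $ i * g $ (l - j) $ (k - i))"
  by (simp add: fps_mult_nth fps_sum_nth)

lemma fps2_eqI: "(\<And>i j. f $ j $ i = g $ j $ i) \<Longrightarrow> f = (g :: 'k fps2)"
  by (simp add: fps_eq_iff)

lemma nth_nth_mult_0_0: "(f * g) $ 0 $ 0 = f $ 0 $ 0 * (g $ 0 $ 0 :: 'k::comm_ring_1)"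
  by (simp add: nth_nth_mult)

lemma varX_power: "varX ^ n = fps_const (fps_X ^ n)"
  by (simp add: varX_def fps_const_power)

lemma varX_power_mult_nth:
  fixes f :: "'k::comm_ring_1 fps2"
  shows "(varX ^ n * f) $ j $ i = (if i < n then 0 else f $ j $ (i - n))"
  by (simp add: varX_power fps_X_power_mult_nth)

lemma varX_mult_nth:
  fixes f :: "'k::comm_ring_1 fps2"
  shows "(varX * f) $ j $ i = (if i = 0 then 0 else f $ j $ (i - 1))"
  using varX_power_mult_nth[of 1 f j i] by simp

lemma varX_power_dvd_iff:
  fixes f :: "'k::comm_ring_1 fps2"
  shows "varX ^ n dvd f \<longleftrightarrow> (\<forall>j. \<forall>i<n. f $ j $ i = 0)"
proof
  assume "varX ^ n dvd f"
  then show "\<forall>j. \<forall>i<n. f $ j $ i = 0"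
    by (auto simp: dvd_def varX_power_mult_nth)
next
  assume *: "\<forall>j. \<forall>i<n. f $ j $ i = 0"
  have "f = varX ^ n * Abs_fps (\<lambda>j. fps_shift n (f $ j))"
    by (rule fps2_eqI) (use * in \<open>auto simp: varX_power_mult_nth\<close>)
  then show "varX ^ n dvd f" by (rule dvdI)
qed

lemma is_unit_fps2_iff:
  fixes f :: "'k::field fps2"
  shows "f dvd 1 \<longleftrightarrow> f $ 0 $ 0 \<noteq> 0"
proof
  assume "f dvd 1"
  then obtain g where "1 = f * g" by (auto simp: dvd_def)
  then have "f $ 0 $ 0 * g $ 0 $ 0 = 1"
    by (metis fps_one_nth nth_nth_mult_0_0)
  then show "f $ 0 $ 0 \<noteq> 0" by auto
next
  assume "f $ 0 $ 0 \<noteq> 0"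
  then have "f $ 0 * inverse (f $ 0) = 1"
    by (metis inverse_mult_eq_1')
  then have "f * fps_right_inverse f (inverse (f $ 0)) = 1"
    by (rule fps_right_inverse)
  then show "f dvd 1" by (metis dvdI)
qed

subsection \<open>Grading by total degree\<close>

text \<open>
  The series $f(t, t y)$ in $t$ over $K[y]$: its coefficient of $t^d$ is the homogeneous part of $f$
  of degree $d$, dehomogenized at $x = 1$. The order of $f$ becomes the subdegree of a power series
  over an integral domain, and a linear substitution becomes a substitution in each coefficient.
\<close>

definition graded :: "'k::comm_ring_1 fps2 \<Rightarrow> 'k poly fps" where
  "graded f = Abs_fps (\<lambda>d. Poly (map (\<lambda>j. f $ j $ (d - j)) [0..<Suc d]))"

lemma coeff_graded: "coeff (graded f $ d) j = (if j \<le> d then f $ j $ (d - j) else 0)"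
  by (simp add: graded_def nth_default_def del: upt_Suc)

lemma degree_graded: "degree (graded f $ d) \<le> d"
  by (intro degree_le) (simp add: coeff_graded)

lemma graded_eq_iff: "graded f = graded g \<longleftrightarrow> f = g"
proof
  assume *: "graded f = graded g"
  show "f = g"
  proof (rule fps2_eqI)
    fix i j
    have "coeff (graded f $ (i + j)) j = coeff (graded g $ (i + j)) j" using * by simp
    then show "f $ j $ i = g $ j $ i" by (simp add: coeff_graded)
  qed
qed simp

lemma graded_surj:
  assumes "\<And>d. degree (F $ d) \<le> d"
  shows "graded (Abs_fps (\<lambda>j. Abs_fps (\<lambda>i. coeff (F $ (i + j)) j))) = F"
proof (rule fps_ext)
  fix d
  show "graded (Abs_fps (\<lambda>j. Abs_fps (\<lambda>i. coeff (F $ (i + j)) j))) $ d = F $ d"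
    using assms[of d] by (intro poly_eqI) (auto simp: coeff_graded coeff_eq_0)
qed

lemma graded_add: "graded (f + g) = graded f + graded g"
  by (intro fps_ext poly_eqI) (simp add: coeff_graded)

text \<open>
  Substitution is multiplicative. In coefficients, a term of total degree $e$ and degree $j$ in $y$
  has degree $e - j$ in $x$.
\<close>

lemma graded_mult: "graded (f * g) = graded f * graded g"
proof (intro fps_ext poly_eqI)
  fix d l
  have "coeff ((graded f * graded g) $ d) l =
     (\<Sum>e=0..d. \<Sum>j\<le>l. coeff (graded f $ e) j * coeff (graded g $ (d - e)) (l - j))"
    by (simp add: fps_mult_nth coeff_sum coeff_mult)
  also have "\<dots> = (\<Sum>j\<le>l. \<Sum>e=0..d. coeff (graded f $ e) j * coeff (graded g $ (d - e)) (l - j))"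
    by (rule sum.swap)
  also have "\<dots> = coeff (graded (f * g) $ d) l"
  proof (cases "l \<le> d")
    case False
    have "coeff (graded f $ e) j * coeff (graded g $ (d - e)) (l - j) = 0" if "e \<le> d" for e j
      using that False by (auto simp: coeff_graded)
    then show ?thesis using False by (simp add: coeff_graded)
  next
    case True
    have "(\<Sum>e=0..d. coeff (graded f $ e) j * coeff (graded g $ (d - e)) (l - j)) =
       (\<Sum>i=0..d-l. f $ j $ i * g $ (l - j) $ (d - l - i))" if "j \<le> l" for j
    proof -
      have "(\<Sum>e=0..d. coeff (graded f $ e) j * coeff (graded g $ (d - e)) (l - j)) =
        (\<Sum>e=j..d-l+j. coeff (graded f $ e) j * coeff (graded g $ (d - e)) (l - j))"
        using that True by (intro sum.mono_neutral_right) (auto simp: coeff_graded)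
      also have "\<dots> = (\<Sum>i=0..d-l. f $ j $ i * g $ (l - j) $ (d - l - i))"
        by (rule sum.reindex_bij_witness[of _ "\<lambda>i. i + j" "\<lambda>e. e - j"])
          (use that True in \<open>auto simp: coeff_graded add.commute\<close>)
      finally show ?thesis .
    qed
    then show ?thesis using True
      by (simp add: coeff_graded nth_nth_mult atLeast0AtMost)
  qed
  finally show "coeff (graded (f * g) $ d) l = coeff ((graded f * graded g) $ d) l" ..
qed

lemma graded_const2: "graded (const2 c) = fps_const [:c:]"
  by (intro fps_ext poly_eqI) (auto simp: coeff_graded const2_def coeff_pCons split: nat.split)

lemma graded_0: "graded 0 = 0"
  by (intro fps_ext poly_eqI) (auto simp: coeff_graded)

lemma graded_1: "graded 1 = 1"
  using graded_const2[of 1] by (simp add: const2_def flip: one_pCons)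

lemma graded_power: "graded (f ^ n) = graded f ^ n"
  by (induction n) (auto simp: graded_mult graded_1)

lemma graded_eq_0_iff: "graded f = 0 \<longleftrightarrow> f = 0"
  using graded_eq_iff[of f 0] by (simp add: graded_0)

lemma graded_nth_eq_0_iff: "graded f $ d = 0 \<longleftrightarrow> (\<forall>i j. i + j = d \<longrightarrow> f $ j $ i = 0)"
proof
  assume *: "graded f $ d = 0"
  show "\<forall>i j. i + j = d \<longrightarrow> f $ j $ i = 0"
  proof (intro allI impI)
    fix i j assume "i + j = d"
    moreover have "coeff (graded f $ d) j = 0" using * by simp
    ultimately show "f $ j $ i = 0" by (auto simp: coeff_graded)
  qed
next
  assume "\<forall>i j. i + j = d \<longrightarrow> f $ j $ i = 0"
  then show "graded f $ d = 0" by (intro poly_eqI) (auto simp: coeff_graded)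
qed

lemma ord2_eq_subdegree:
  assumes "f \<noteq> 0"
  shows "ord2 f = subdegree (graded f)"
proof -
  have "(\<exists>i j. i + j = n \<and> coeff2 f i j \<noteq> 0) \<longleftrightarrow> graded f $ n \<noteq> 0" for n
    by (auto simp: graded_nth_eq_0_iff coeff2_def)
  then show ?thesis
    using assms by (simp add: ord2_def subdegree_def graded_eq_0_iff)
qed

lemma ord2_mult:
  fixes f g :: "'k::field fps2"
  assumes "f \<noteq> 0" "g \<noteq> 0"
  shows "ord2 (f * g) = ord2 f + ord2 g"
  using assms by (simp add: ord2_eq_subdegree graded_mult graded_eq_0_iff)

lemma ord2_eqI:
  assumes "\<And>i j. i + j < n \<Longrightarrow> f $ j $ i = 0" and "i + j = n" and "f $ j $ i \<noteq> 0"
  shows "ord2 f = n"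
  unfolding ord2_def coeff2_def
  using assms by (intro Least_equality) (auto simp: not_less[symmetric])

lemma nth_eq_0_of_less_ord2: "i + j < ord2 f \<Longrightarrow> f $ j $ i = 0"
  unfolding ord2_def coeff2_def using not_less_Least by blast

lemma ord2_witness:
  assumes "f \<noteq> 0"
  obtains i j where "i + j = ord2 f" and "f $ j $ i \<noteq> 0"
proof -
  have "\<exists>n i j. i + j = n \<and> f $ j $ i \<noteq> 0" using assms by (auto simp: fps_eq_iff)
  then have "\<exists>i j. i + j = ord2 f \<and> f $ j $ i \<noteq> 0"
    unfolding ord2_def coeff2_def by (rule LeastI_ex)
  then show ?thesis using that by blast
qed

lemma ord2_leI: "f $ j $ i \<noteq> 0 \<Longrightarrow> ord2 f \<le> i + j"
  using nth_eq_0_of_less_ord2[of i j f] by fastforce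

lemma ord2_eq_0_iff:
  fixes f :: "'k::field fps2"
  assumes "f \<noteq> 0"
  shows "ord2 f = 0 \<longleftrightarrow> f dvd 1"
  using assms
  by (metis add_is_0 is_unit_fps2_iff le_zero_eq ord2_leI ord2_witness)

lemma algebroid_curve_iff:
  fixes f :: "'k::field fps2"
  shows "algebroid_curve f \<longleftrightarrow> f \<noteq> 0 \<and> \<not> f dvd 1"
  by (simp add: algebroid_curve_def has_no_const_def coeff2_def is_unit_fps2_iff)

lemma algebroid_curve_iff_ord2:
  fixes f :: "'k::field fps2"
  shows "algebroid_curve f \<longleftrightarrow> f \<noteq> 0 \<and> ord2 f > 0"
  using ord2_eq_0_iff[of f] by (auto simp: algebroid_curve_iff)

lemma branch_iff_irreducible: "branch (f :: 'k::field fps2) \<longleftrightarrow> irreducible f"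
  by (auto simp: branch_def algebroid_curve_iff irreducible_def)

lemma smooth_curve_iff_ord2:
  fixes f :: "'k::field fps2"
  shows "smooth_curve f \<longleftrightarrow> f \<noteq> 0 \<and> ord2 f = 1"
  by (auto simp: smooth_curve_def algebroid_curve_iff_ord2 curve_mult_def)

lemma smooth_curve_irreducible:
  fixes f :: "'k::field fps2"
  assumes "smooth_curve f"
  shows "irreducible f"
proof (rule irreducibleI)
  show "f \<noteq> 0" "\<not> f dvd 1"
    using assms by (auto simp: smooth_curve_def algebroid_curve_iff)
next
  fix a b assume *: "f = a * b"
  then have "a \<noteq> 0" "b \<noteq> 0" "ord2 a + ord2 b = 1"
    using assms by (auto simp: smooth_curve_iff_ord2 simp flip: ord2_mult)
  then show "a dvd 1 \<or> b dvd 1"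
    using ord2_eq_0_iff[of a] ord2_eq_0_iff[of b] by auto
qed

text \<open>
  Orders add up in products and only units have order $0$, so splitting off factors terminates.
\<close>

lemma irreducible_factor_exists:
  fixes f :: "'k::field fps2"
  assumes "f \<noteq> 0" "\<not> f dvd 1"
  shows "\<exists>p. irreducible p \<and> p dvd f"
  using assms
proof (induction "ord2 f" arbitrary: f rule: less_induct)
  case less
  show ?case
  proof (cases "irreducible f")
    case False
    then obtain a b where ab: "f = a * b" "\<not> a dvd 1" "\<not> b dvd 1"
      using less.prems by (auto simp: irreducible_def)
    then have "a \<noteq> 0" "b \<noteq> 0" using less.prems by auto
    then have "ord2 a < ord2 f"
      using ab ord2_eq_0_iff[of b] by (simp add: ord2_mult)
    from less.hyps[OF this \<open>a \<noteq> 0\<close> ab(2)] show ?thesis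
      using ab(1) by (meson dvd_trans dvd_triv_left)
  qed auto
qed

section \<open>Invariance of contact under linear changes of coordinates\<close>

text \<open>
  The invariants of curves are defined from the ring structure, the constants and the order, hence
  they are preserved by every automorphism that preserves these. The inverse is a parameter of the
  locale because each inequality between invariants is needed in both directions.
\<close>

locale K_automorphism =
  fixes \<sigma> \<tau> :: "'k::field fps2 \<Rightarrow> 'k fps2"
  assumes add: "\<sigma> (f + g) = \<sigma> f + \<sigma> g"
    and mult: "\<sigma> (f * g) = \<sigma> f * \<sigma> g"
    and const2: "\<sigma> (const2 c) = const2 c"
    and ord2: "ord2 (\<sigma> f) = ord2 f"
    and left_inverse: "\<tau> (\<sigma> f) = f"
    and right_inverse: "\<sigma> (\<tau> f) = f"
begin

lemma inverse_automorphism: "K_automorphism \<tau> \<sigma>"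
proof
  show "\<tau> (f + g) = \<tau> f + \<tau> g" for f g
    by (metis add left_inverse right_inverse)
  show "\<tau> (f * g) = \<tau> f * \<tau> g" for f g
    by (metis mult left_inverse right_inverse)
  show "\<tau> (const2 c) = const2 c" for c
    by (metis const2 left_inverse)
  show "ord2 (\<tau> f) = ord2 f" for f
    by (metis ord2 right_inverse)
qed (rule right_inverse left_inverse)+

lemma eq_iff: "\<sigma> f = \<sigma> g \<longleftrightarrow> f = g"
  by (metis left_inverse)

lemma zero: "\<sigma> 0 = 0"
proof -
  have "\<sigma> 0 + \<sigma> 0 = \<sigma> 0 + 0" using add[of 0 0, symmetric] by simp
  then show ?thesis by (rule add_left_imp_eq)
qed

lemma one: "\<sigma> 1 = 1"
  using const2[of 1] by (simp add: const2_def)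

lemma diff: "\<sigma> (f - g) = \<sigma> f - \<sigma> g"
  by (metis add add_diff_cancel_right' diff_add_cancel)

lemma sum: "\<sigma> (\<Sum>x\<in>A. F x) = (\<Sum>x\<in>A. \<sigma> (F x))"
  by (induction A rule: infinite_finite_induct) (auto simp: zero add)

lemma eq_0_iff: "\<sigma> f = 0 \<longleftrightarrow> f = 0"
  using eq_iff[of f 0] by (simp add: zero)

lemma dvd_iff: "\<sigma> f dvd \<sigma> g \<longleftrightarrow> f dvd g"
proof
  assume "\<sigma> f dvd \<sigma> g"
  then obtain h where "\<sigma> g = \<sigma> f * h" by (auto simp: dvd_def)
  then have "\<sigma> g = \<sigma> (f * \<tau> h)" by (simp add: mult right_inverse)
  then show "f dvd g" by (simp add: eq_iff)
qed (auto simp: dvd_def mult)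

lemma dvd_1_iff: "\<sigma> f dvd 1 \<longleftrightarrow> f dvd 1"
  using dvd_iff[of f 1] by (simp add: one)

lemma irreducible:
  assumes "irreducible f"
  shows "irreducible (\<sigma> f)"
proof (rule irreducibleI)
  show "\<sigma> f \<noteq> 0" "\<not> \<sigma> f dvd 1"
    using assms by (auto simp: irreducible_def eq_0_iff dvd_1_iff)
next
  fix a b assume "\<sigma> f = a * b"
  then have "\<sigma> f = \<sigma> (\<tau> a * \<tau> b)" by (simp add: mult right_inverse)
  then have "f = \<tau> a * \<tau> b" by (simp add: eq_iff)
  then have "\<tau> a dvd 1 \<or> \<tau> b dvd 1" using assms by (auto dest: irreducibleD)
  then show "a dvd 1 \<or> b dvd 1"
    using dvd_1_iff[of "\<tau> a"] dvd_1_iff[of "\<tau> b"] by (simp add: right_inverse)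
qed

lemma irreducible_iff: "irreducible (\<sigma> f) \<longleftrightarrow> irreducible f"
  using irreducible[of f] K_automorphism.irreducible[OF inverse_automorphism, of "\<sigma> f"]
  by (auto simp: left_inverse)

lemma branch_iff: "branch (\<sigma> f) \<longleftrightarrow> branch f"
  by (simp add: branch_iff_irreducible irreducible_iff)

lemma smooth_curve_iff: "smooth_curve (\<sigma> f) \<longleftrightarrow> smooth_curve f"
  by (simp add: smooth_curve_iff_ord2 ord2 eq_0_iff)

lemma branches: "branches (\<sigma> f) = \<sigma> ` branches f"
proof (intro equalityI subsetI)
  fix g assume "g \<in> branches (\<sigma> f)"
  then have "\<tau> g \<in> branches f"
    using branch_iff[of "\<tau> g"] dvd_iff[of "\<tau> g" f] by (simp add: branches_def right_inverse)
  then show "g \<in> \<sigma> ` branches f"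
    by (metis image_eqI right_inverse)
qed (auto simp: branches_def branch_iff dvd_iff)

lemma image_ideal2: "\<sigma> ` ideal2 f g = ideal2 (\<sigma> f) (\<sigma> g)"
proof (intro equalityI subsetI)
  fix h assume "h \<in> ideal2 (\<sigma> f) (\<sigma> g)"
  then obtain p q where "h = p * \<sigma> f + q * \<sigma> g" by (auto simp: ideal2_def)
  then have "h = \<sigma> (\<tau> p * f + \<tau> q * g)"
    by (simp add: add mult right_inverse)
  then show "h \<in> \<sigma> ` ideal2 f g" by (auto simp: ideal2_def)
next
  fix h assume "h \<in> \<sigma> ` ideal2 f g"
  then obtain p q where "h = \<sigma> p * \<sigma> f + \<sigma> q * \<sigma> g" by (auto simp: ideal2_def add mult)
  then show "h \<in> ideal2 (\<sigma> f) (\<sigma> g)" unfolding ideal2_def by blast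
qed

lemma quotient_basis:
  assumes "quotient_basis I B"
  shows "quotient_basis (\<sigma> ` I) (\<sigma> ` B)"
proof -
  have inj: "inj_on \<sigma> A" for A by (auto simp: inj_on_def eq_iff)
  have img: "\<sigma> x \<in> \<sigma> ` I \<longleftrightarrow> x \<in> I" for x by (auto simp: eq_iff)
  have comb: "(\<Sum>b\<in>\<sigma> ` B. const2 (c b) * b) = \<sigma> (\<Sum>b\<in>B. const2 (c (\<sigma> b)) * b)" for c
    by (simp add: sum.reindex[OF inj] sum mult const2)
  have fin: "finite B"
    and indep: "(\<Sum>b\<in>B. const2 (c b) * b) \<in> I \<Longrightarrow> b \<in> B \<Longrightarrow> c b = 0"
    and span: "\<exists>c. h - (\<Sum>b\<in>B. const2 (c b) * b) \<in> I" for c b h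
    using assms by (auto simp: quotient_basis_def)
  show ?thesis unfolding quotient_basis_def
  proof (intro conjI allI impI ballI)
    show "finite (\<sigma> ` B)" using fin by simp
  next
    fix c b assume "(\<Sum>b\<in>\<sigma> ` B. const2 (c b) * b) \<in> \<sigma> ` I" "b \<in> \<sigma> ` B"
    then show "c b = 0" using indep[of "\<lambda>b. c (\<sigma> b)"] by (auto simp: comb img)
  next
    fix h
    obtain c where c: "\<tau> h - (\<Sum>b\<in>B. const2 (c b) * b) \<in> I" using span by blast
    have "h - (\<Sum>b\<in>\<sigma> ` B. const2 (c (\<tau> b)) * b) = \<sigma> (\<tau> h - (\<Sum>b\<in>B. const2 (c b) * b))"
      by (simp add: comb left_inverse right_inverse diff)
    with c have "h - (\<Sum>b\<in>\<sigma> ` B. const2 (c (\<tau> b)) * b) \<in> \<sigma> ` I" by simp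
    then show "\<exists>c. h - (\<Sum>b\<in>\<sigma> ` B. const2 (c b) * b) \<in> \<sigma> ` I"
      by (rule exI[of _ "\<lambda>b. c (\<tau> b)"])
  qed
qed

lemma quotient_dim_le: "quotient_dim (\<sigma> ` I) \<le> quotient_dim I"
  unfolding quotient_dim_def
proof (rule INF_mono)
  fix B assume "B \<in> {B. quotient_basis I B}"
  then have "quotient_basis (\<sigma> ` I) (\<sigma> ` B)" by (simp add: quotient_basis)
  moreover have "card (\<sigma> ` B) = card B" by (intro card_image) (auto simp: inj_on_def eq_iff)
  ultimately show "\<exists>B'\<in>{B. quotient_basis (\<sigma> ` I) B}. enat (card B') \<le> enat (card B)" by auto
qed

lemma intersection_mult: "intersection_mult (\<sigma> f) (\<sigma> g) = intersection_mult f g"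
proof (rule antisym)
  show "intersection_mult (\<sigma> f) (\<sigma> g) \<le> intersection_mult f g"
    unfolding intersection_mult_def image_ideal2[symmetric] by (rule quotient_dim_le)
  have "\<tau> ` ideal2 (\<sigma> f) (\<sigma> g) = ideal2 f g"
    using K_automorphism.image_ideal2[OF inverse_automorphism, of "\<sigma> f" "\<sigma> g"]
    by (simp only: left_inverse)
  then show "intersection_mult f g \<le> intersection_mult (\<sigma> f) (\<sigma> g)"
    unfolding intersection_mult_def
    using K_automorphism.quotient_dim_le[OF inverse_automorphism, of "ideal2 (\<sigma> f) (\<sigma> g)"]
    by (simp only:)
qed

lemma branch_contact: "branch_contact (\<sigma> f) (\<sigma> g) = branch_contact f g"
  by (simp add: branch_contact_def intersection_mult curve_mult_def ord2)

lemma contact: "contact (\<sigma> f) (\<sigma> g) = contact f g"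
proof -
  have "branches (\<sigma> f) \<times> branches (\<sigma> g) = map_prod \<sigma> \<sigma> ` (branches f \<times> branches g)"
    by (simp add: branches map_prod_surj_on)
  then show ?thesis
    by (simp add: contact_def image_comp case_prod_unfold o_def branch_contact)
qed

lemma contact_exponent: "contact_exponent (\<sigma> f) = contact_exponent f"
proof -
  have "{w :: 'k fps2. branch w \<and> smooth_curve w} = \<sigma> ` {w. branch w \<and> smooth_curve w}"
  proof (intro equalityI subsetI)
    fix w :: "'k fps2" assume "w \<in> {w. branch w \<and> smooth_curve w}"
    then have "\<tau> w \<in> {w. branch w \<and> smooth_curve w}"
      using branch_iff[of "\<tau> w"] smooth_curve_iff[of "\<tau> w"] by (simp add: right_inverse)
    then show "w \<in> \<sigma> ` {w. branch w \<and> smooth_curve w}" by (metis image_eqI right_inverse)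
  qed (auto simp: branch_iff smooth_curve_iff)
  then have "contact_exponent (\<sigma> f) =
     (SUP w \<in> \<sigma> ` {w. branch w \<and> smooth_curve w}. contact (\<sigma> f) w)"
    by (simp add: contact_exponent_def)
  then show ?thesis by (simp add: contact_exponent_def image_comp o_def contact)
qed

lemma maximal_contact_iff: "maximal_contact (\<sigma> w) (\<sigma> f) \<longleftrightarrow> maximal_contact w f"
  unfolding maximal_contact_def branch_iff smooth_curve_iff contact contact_exponent ..

end

subsection \<open>Exchanging the variables\<close>

definition swap :: "'k fps2 \<Rightarrow> 'k fps2" where
  "swap f = Abs_fps (\<lambda>j. Abs_fps (\<lambda>i. f $ i $ j))"

lemma swap_nth [simp]: "swap f $ j $ i = f $ i $ j"
  by (simp add: swap_def)

lemma swap_swap [simp]: "swap (swap f) = f"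
  by (rule fps2_eqI) simp

lemma ord2_swap: "ord2 (swap f) = ord2 f"
proof -
  have "(\<exists>i j. i + j = n \<and> coeff2 (swap f) i j \<noteq> 0) \<longleftrightarrow> (\<exists>i j. i + j = n \<and> coeff2 f i j \<noteq> 0)" for n
    unfolding coeff2_def by (metis add.commute swap_nth)
  then show ?thesis by (simp add: ord2_def)
qed

lemma swap_const2: "swap (const2 c) = const2 c"
  by (rule fps2_eqI) (auto simp: const2_def fps_const_def)

lemma swap_mult: "swap (f * g) = swap f * swap (g :: 'k::field fps2)"
  by (rule fps2_eqI) (simp add: nth_nth_mult, rule sum.swap)

lemma K_automorphism_swap: "K_automorphism swap (swap :: 'k::field fps2 \<Rightarrow> _)"
proof
  show "swap (f + g) = swap f + swap (g :: 'k fps2)" for f g by (rule fps2_eqI) simp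
qed (simp_all add: swap_mult swap_const2 ord2_swap)

lemma swap_varX: "swap varX = (varY :: 'k::field fps2)"
  by (rule fps2_eqI) (auto simp: varX_def varY_def fps_X_def)

lemma swap_varY: "swap varY = (varX :: 'k::field fps2)"
  by (metis swap_swap swap_varX)

lemma swap_power: "swap (f ^ n) = swap (f :: 'k::field fps2) ^ n"
  using K_automorphism.one[OF K_automorphism_swap]
  by (induction n) (auto simp: swap_mult)

subsection \<open>Shears\<close>

text \<open>
  The series $f(x, y + a x)$: on the dehomogenized part of degree $d$ it acts by $y \mapsto y + a$.
\<close>

definition shear :: "'k::field \<Rightarrow> 'k fps2 \<Rightarrow> 'k fps2" where
  "shear a f = Abs_fps (\<lambda>j. Abs_fps (\<lambda>i. coeff (graded f $ (i + j) \<circ>\<^sub>p [:a, 1:]) j))"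

lemma graded_shear_nth: "graded (shear a f) $ d = graded f $ d \<circ>\<^sub>p [:a, 1:]"
proof -
  define F where "F = Abs_fps (\<lambda>d. graded f $ d \<circ>\<^sub>p [:a, 1:])"
  have "degree (F $ d) \<le> d" for d
    using degree_graded[of f d] by (simp add: F_def degree_pcompose)
  then have "graded (Abs_fps (\<lambda>j. Abs_fps (\<lambda>i. coeff (F $ (i + j)) j))) = F"
    by (rule graded_surj)
  then show ?thesis by (simp add: F_def shear_def)
qed

lemma shear_eqI: "(\<And>d. graded f $ d \<circ>\<^sub>p [:a, 1:] = graded g $ d) \<Longrightarrow> shear a f = g"
  by (subst graded_eq_iff[symmetric]) (simp add: fps_eq_iff graded_shear_nth)

lemma shear_shear: "shear a (shear b f) = shear (a + b) f"
  by (rule shear_eqI) (simp add: graded_shear_nth pcompose_assoc[symmetric] pcompose_pCons add.commute)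

lemma shear_0: "shear 0 f = f"
  by (rule shear_eqI) (simp add: pcompose_idR)

lemma shear_add: "shear a (f + g) = shear a f + shear a g"
  by (rule shear_eqI) (simp add: graded_add graded_shear_nth pcompose_add)

lemma shear_mult: "shear a (f * g) = shear a f * shear a g"
  by (rule shear_eqI)
    (simp add: graded_mult fps_mult_nth graded_shear_nth pcompose_mult pcompose_sum)

lemma shear_const2: "shear a (const2 c) = const2 c"
  by (rule shear_eqI) (simp add: graded_const2 pcompose_const)

lemma ord2_shear: "ord2 (shear a f) = ord2 f"
proof -
  have "graded (shear a f) $ d = 0 \<longleftrightarrow> graded f $ d = 0" for d
    by (simp add: graded_shear_nth pcompose_eq_0_iff)
  then have "(\<exists>i j. i + j = n \<and> coeff2 (shear a f) i j \<noteq> 0) \<longleftrightarrow>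
      (\<exists>i j. i + j = n \<and> coeff2 f i j \<noteq> 0)" for n
    unfolding coeff2_def using graded_nth_eq_0_iff by metis
  then show ?thesis by (simp add: ord2_def)
qed

lemma K_automorphism_shear: "K_automorphism (shear a) (shear (-a))"
  by standard (simp_all add: shear_add shear_mult shear_const2 ord2_shear shear_shear shear_0)

section \<open>Weierstrass division\<close>

lemma eq_0_if_varX_powers_dvd:
  fixes f :: "'k::comm_ring_1 fps2"
  assumes "\<And>n. varX ^ n dvd f"
  shows "f = 0"
proof (rule fps2_eqI)
  fix i j
  show "f $ j $ i = 0 $ j $ i" using assms[of "Suc i"] unfolding varX_power_dvd_iff by simp
qed

text \<open>
  The ring is complete for the $x$-adic topology, so the iterates of a contraction converge. The
  coefficient of $x^i$ is the same in all iterates from the one with number $i + 1$ on.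
\<close>

lemma varX_adic_fixpoint:
  fixes \<Phi> :: "'k::comm_ring_1 fps2 \<Rightarrow> 'k fps2"
  assumes contraction: "\<And>n p q. varX ^ n dvd p - q \<Longrightarrow> varX ^ Suc n dvd \<Phi> p - \<Phi> q"
  shows "\<exists>q. \<Phi> q = q"
proof -
  define s where "s n = (\<Phi> ^^ n) 0" for n
  have step: "varX ^ n dvd s (Suc n) - s n" for n
  proof (induction n)
    case (Suc n)
    then show ?case using contraction[OF Suc] by (simp add: s_def)
  qed simp
  have cauchy: "varX ^ n dvd s (n + m) - s n" for n m
  proof (induction m)
    case (Suc m)
    have "varX ^ n dvd s (Suc (n + m)) - s (n + m)"
      using step[of "n + m"] by (meson dvd_trans le_add1 le_imp_power_dvd)
    from dvd_add[OF this Suc] show ?case by simp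
  qed simp
  define q where "q = Abs_fps (\<lambda>j. Abs_fps (\<lambda>i. s (Suc i) $ j $ i))"
  have lim: "varX ^ n dvd q - s n" for n
    unfolding varX_power_dvd_iff
  proof (intro allI impI)
    fix j i assume "i < n"
    then have "varX ^ Suc i dvd s n - s (Suc i)" using cauchy[of "Suc i" "n - Suc i"] by simp
    then have "(s n - s (Suc i)) $ j $ i = 0" unfolding varX_power_dvd_iff by blast
    then show "(q - s n) $ j $ i = 0" by (simp add: q_def)
  qed
  have "varX ^ n dvd \<Phi> q - q" for n
  proof -
    have "s (Suc n) = \<Phi> (s n)" by (simp add: s_def)
    then have "varX ^ Suc n dvd (\<Phi> q - s (Suc n)) - (q - s (Suc n))"
      using contraction[OF lim[of n]] lim[of "Suc n"] by (simp only: dvd_diff)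
    then have "varX ^ Suc n dvd \<Phi> q - q" by simp
    then show ?thesis by (rule dvd_trans[rotated]) (simp add: le_imp_power_dvd)
  qed
  then have "\<Phi> q - q = 0" by (rule eq_0_if_varX_powers_dvd)
  then show ?thesis by auto
qed

text \<open>
  The series $h(0, y)$ has order $s$; equivalently $h$ meets the line $x = 0$ with multiplicity $s$.
\<close>

definition y_regular :: "nat \<Rightarrow> 'k::zero fps2 \<Rightarrow> bool" where
  "y_regular s h \<longleftrightarrow> (\<forall>j<s. h $ j $ 0 = 0) \<and> h $ s $ 0 \<noteq> 0"

lemma y_regular_mult:
  fixes f g :: "'k::field fps2"
  assumes "y_regular s f" "y_regular t g"
  shows "y_regular (s + t) (f * g)"
proof -
  have 1: "f $ i $ 0 * g $ (j - i) $ 0 = 0" if "j \<le> s + t" "(j, i) \<noteq> (s + t, s)" "i \<le> j" for i j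
  proof -
    have "i < s \<or> j - i < t" using that by auto
    then show ?thesis using assms by (auto simp: y_regular_def)
  qed
  have "(f * g) $ (s + t) $ 0 = (\<Sum>i=0..s+t. if i = s then f $ s $ 0 * g $ t $ 0 else 0)"
    unfolding nth_nth_mult by (intro sum.cong) (use 1 in auto)
  then have "(f * g) $ (s + t) $ 0 = f $ s $ 0 * g $ t $ 0" by simp
  moreover have "(f * g) $ j $ 0 = 0" if "j < s + t" for j
    unfolding nth_nth_mult using that 1 by (intro sum.neutral) auto
  ultimately show ?thesis using assms by (auto simp: y_regular_def)
qed

lemma y_regular_exists:
  fixes f :: "'k::zero fps2"
  assumes "f $ n $ 0 \<noteq> 0"
  obtains s where "s \<le> n" "y_regular s f"
proof
  show "y_regular (LEAST j. f $ j $ 0 \<noteq> 0) f"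
    unfolding y_regular_def using LeastI[of "\<lambda>j. f $ j $ 0 \<noteq> 0", OF assms]
    by (auto dest: not_less_Least)
  show "(LEAST j. f $ j $ 0 \<noteq> 0) \<le> n" using assms by (rule Least_le)
qed

lemma y_regular_unique: "y_regular s f \<Longrightarrow> y_regular t f \<Longrightarrow> s = t"
  unfolding y_regular_def by (metis linorder_neqE_nat)

lemma y_regular_dvd:
  fixes f g :: "'k::field fps2"
  assumes "y_regular n f" "g dvd f"
  obtains s where "s \<le> n" "y_regular s g"
proof -
  obtain h where h: "f = g * h" using assms(2) by (auto simp: dvd_def)
  have "\<exists>j\<le>n. g $ j $ 0 \<noteq> 0"
  proof (rule ccontr)
    assume "\<not> ?thesis"
    then have "f $ n $ 0 = 0" by (simp add: h nth_nth_mult)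
    then show False using assms(1) by (simp add: y_regular_def)
  qed
  then obtain j where "j \<le> n" "g $ j $ 0 \<noteq> 0" by blast
  moreover obtain s where "s \<le> j" "y_regular s g"
    using y_regular_exists[OF \<open>g $ j $ 0 \<noteq> 0\<close>] .
  ultimately show ?thesis by (intro that[of s]) auto
qed

lemma y_regular_0_iff: "y_regular 0 (f :: 'k::field fps2) \<longleftrightarrow> f dvd 1"
  by (simp add: y_regular_def is_unit_fps2_iff)

lemma fps_shift_varX: "fps_shift s (varX * f) = varX * fps_shift s f"
  by (rule fps2_eqI) (simp add: varX_mult_nth)

lemma fps_shift_varX_power: "fps_shift s (varX ^ n * f) = varX ^ n * fps_shift s f"
  by (rule fps2_eqI) (simp add: varX_power_mult_nth)

text \<open>
  Modulo $x$, the series $h$ is a unit times $y^s$.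
\<close>

lemma y_regular_decomp:
  fixes h :: "'k::field fps2"
  assumes "y_regular s h"
  obtains A U V where "h = varX * A + U * fps_X ^ s" "U * V = 1"
proof -
  define A where "A = Abs_fps (\<lambda>j. if j < s then fps_shift 1 (h $ j) else 0)"
  define U where "U = fps_shift s h"
  have "h = varX * A + U * fps_X ^ s"
  proof (rule fps2_eqI)
    fix i j
    show "h $ j $ i = (varX * A + U * fps_X ^ s) $ j $ i"
      using assms
      by (auto simp: varX_mult_nth A_def U_def fps_X_power_mult_right_nth y_regular_def)
  qed
  moreover have "U dvd 1" using assms by (simp add: is_unit_fps2_iff U_def y_regular_def)
  then obtain V where "U * V = 1" by (metis dvd_def)
  ultimately show ?thesis by (rule that)
qed

text \<open>
  Write $h = x A + U y^s$ with $U V = 1$, and let $S$ drop the terms of degree less than $s$ in $y$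
  and divide by $y^s$. A remainder of degree less than $s$ in $y$ is left exactly when
  $S(q h) = S(p)$, that is, $q = V (S(p) - x S(q A))$. The factor $x$ makes the right-hand side a
  contraction in $q$.
\<close>

theorem Weierstrass_division:
  fixes h p :: "'k::field fps2"
  assumes "y_regular s h"
  obtains q r where "p = q * h + r" "fps_shift s r = 0"
proof -
  obtain A U V where h: "h = varX * A + U * fps_X ^ s" and UV: "U * V = 1"
    using y_regular_decomp[OF assms] .
  define \<Phi> where "\<Phi> q = V * (fps_shift s p - varX * fps_shift s (q * A))" for q
  have "\<exists>q. \<Phi> q = q"
  proof (rule varX_adic_fixpoint)
    fix n and q q' :: "'k fps2" assume "varX ^ n dvd q - q'"
    then obtain d where d: "q - q' = varX ^ n * d" by (auto simp: dvd_def)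
    have "\<Phi> q - \<Phi> q' = - (V * (varX * fps_shift s ((q - q') * A)))"
      by (simp add: \<Phi>_def algebra_simps fps_shift_diff)
    also have "\<dots> = varX ^ Suc n * - (V * fps_shift s (d * A))"
      by (simp add: d mult.assoc fps_shift_varX_power mult.left_commute[of V])
    finally show "varX ^ Suc n dvd \<Phi> q - \<Phi> q'" by (rule dvdI)
  qed
  then obtain q where q: "\<Phi> q = q" by blast
  have "q * U = U * V * (fps_shift s p - varX * fps_shift s (q * A))"
    by (subst q[symmetric]) (simp add: \<Phi>_def mult_ac)
  then have qU: "q * U = fps_shift s p - varX * fps_shift s (q * A)" by (simp add: UV)
  have "fps_shift s (p - q * h) = fps_shift s p - (varX * fps_shift s (q * A) + q * U)"
    by (simp add: h distrib_left fps_shift_diff fps_shift_add mult.left_commute[of q varX]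
        fps_shift_varX mult.assoc[of q U, symmetric])
  then have "fps_shift s (p - q * h) = 0" by (simp add: qU)
  then show ?thesis by (intro that[of q "p - q * h"]) simp_all
qed

text \<open>
  The difference of two quotients satisfies the hypothesis. The equation of the existence proof with
  $p = 0$ then shows that $q$ is divisible by every power of $x$.
\<close>

theorem Weierstrass_division_unique:
  fixes h q :: "'k::field fps2"
  assumes "y_regular s h" "fps_shift s (q * h) = 0"
  shows "q = 0"
proof -
  obtain A U V where h: "h = varX * A + U * fps_X ^ s" and UV: "U * V = 1"
    using y_regular_decomp[OF assms(1)] .
  have "fps_shift s (q * h) = varX * fps_shift s (q * A) + q * U"
    by (simp add: h distrib_left fps_shift_add mult.left_commute[of q varX]
        fps_shift_varX mult.assoc[of q U, symmetric])
  then have "q * U = - (varX * fps_shift s (q * A))"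
    using assms(2) by (simp add: eq_neg_iff_add_eq_0 add.commute)
  then have "q * U * V = - (varX * fps_shift s (q * A)) * V" by simp
  then have q: "q = varX * - (fps_shift s (q * A) * V)"
    by (simp add: mult.assoc UV)
  have "varX ^ n dvd q" for n
  proof (induction n)
    case (Suc n)
    then obtain d where "q = varX ^ n * d" by (auto simp: dvd_def)
    then have "q = varX * - (varX ^ n * fps_shift s (d * A) * V)"
      by (subst q) (simp add: mult.assoc fps_shift_varX_power)
    then have "q = varX ^ Suc n * - (fps_shift s (d * A) * V)" by (simp add: mult_ac)
    then show ?case by (rule dvdI)
  qed simp
  then show ?thesis by (rule eq_0_if_varX_powers_dvd)
qed

text \<open>
  Divide $y^s$ by $h$. As $h(0, y)$ has order exactly $s$, the quotient has a nonzero constant term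
  and the remainder vanishes at $x = 0$.
\<close>

theorem Weierstrass_preparation:
  fixes h :: "'k::field fps2"
  assumes "y_regular s h"
  obtains u P where "u dvd 1" "P = u * h" "P $ s = 1"
    "\<And>j. j > s \<Longrightarrow> P $ j = 0" "\<And>j. j < s \<Longrightarrow> P $ j $ 0 = 0"
proof -
  obtain q r where q: "fps_X ^ s = q * h + r" and r: "fps_shift s r = 0"
    using Weierstrass_division[OF assms] .
  have r0: "r $ j = 0" if "j \<ge> s" for j
  proof -
    have "r $ j = fps_shift s r $ (j - s)" using that by simp
    then show ?thesis using r by simp
  qed
  have qh: "q * h = fps_X ^ s - r" using q by simp
  have "(q * h) $ s $ 0 = (\<Sum>i=0..s. if i = 0 then q $ 0 $ 0 * h $ s $ 0 else 0)"
    unfolding nth_nth_mult by (intro sum.cong) (use assms in \<open>auto simp: y_regular_def\<close>)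
  then have "q $ 0 $ 0 * h $ s $ 0 = 1" by (simp add: qh r0)
  then have "q dvd 1" by (auto simp: is_unit_fps2_iff)
  moreover have "(q * h) $ j $ 0 = 0" if "j < s" for j
    unfolding nth_nth_mult using assms that by (intro sum.neutral) (auto simp: y_regular_def)
  ultimately show ?thesis
    by (intro that[of q "q * h"]) (auto simp: qh r0)
qed

section \<open>The quadratic transform\<close>

text \<open>
  The total transform $f(x, x y)$.
\<close>

definition blowup :: "'k::comm_ring_1 fps2 \<Rightarrow> 'k fps2" where
  "blowup f = Abs_fps (\<lambda>j. fps_X ^ j * f $ j)"

lemma blowup_nth: "blowup f $ j = fps_X ^ j * f $ j"
  by (simp add: blowup_def)

lemma blowup_nth_nth: "blowup f $ j $ i = (if i < j then 0 else f $ j $ (i - j))"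
  by (simp add: blowup_nth fps_X_power_mult_nth)

lemma blowup_add: "blowup (f + g) = blowup f + blowup g"
  by (rule fps_ext) (simp add: blowup_nth distrib_left)

lemma blowup_mult: "blowup (f * g) = blowup f * blowup g"
proof (rule fps_ext)
  fix n
  have "fps_X ^ n * (f $ i * g $ (n - i)) = fps_X ^ i * f $ i * (fps_X ^ (n - i) * g $ (n - i))"
    if "i \<le> n" for i
  proof -
    have "fps_X ^ n = fps_X ^ i * (fps_X ^ (n - i) :: 'a fps)" using that by (simp flip: power_add)
    then show ?thesis by (simp only: mult_ac)
  qed
  then show "blowup (f * g) $ n = (blowup f * blowup g) $ n"
    by (simp add: blowup_nth fps_mult_nth sum_distrib_left)
qed

lemma blowup_eq_0_iff: "blowup f = 0 \<longleftrightarrow> f = (0 :: 'k::field fps2)"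
  by (simp add: fps_eq_iff[of "blowup f"] fps_eq_iff[of f] blowup_nth)

lemma blowup_fps_const: "blowup (fps_const c) = fps_const c"
  by (rule fps_ext) (simp add: blowup_nth)

text \<open>
  For $f$ of order at least $n$ this is $x^{-n} f(x, x y)$: the monomial $x^i y^j$ becomes
  $x^{i+j-n} y^j$. Monomials with $i + j < n$ are discarded.
\<close>

definition transform :: "nat \<Rightarrow> 'k::zero fps2 \<Rightarrow> 'k fps2" where
  "transform n f = Abs_fps (\<lambda>j. Abs_fps (\<lambda>i. if j \<le> i + n then f $ j $ (i + n - j) else 0))"

lemma transform_nth: "transform n f $ j $ i = (if j \<le> i + n then f $ j $ (i + n - j) else 0)"
  by (simp add: transform_def)

lemma varX_power_mult_transform:
  assumes "\<And>i j. i + j < n \<Longrightarrow> f $ j $ i = 0"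
  shows "varX ^ n * transform n f = blowup f"
  by (rule fps2_eqI) (use assms in \<open>auto simp: varX_power_mult_nth transform_nth blowup_nth_nth\<close>)

lemma transform_eqI:
  fixes f :: "'k::field fps2"
  assumes "varX ^ n * g = blowup f"
  shows "transform n f = g"
proof (rule fps2_eqI)
  fix i j
  have "g $ j $ i = (varX ^ n * g) $ j $ (i + n)" by (simp add: varX_power_mult_nth)
  then show "transform n f $ j $ i = g $ j $ i"
    by (simp add: assms blowup_nth_nth transform_nth)
qed

text \<open>
  Up to a unit, the factor $h$ is a polynomial $P$ in $y$, monic of degree $s$, whose other
  coefficients vanish at $x = 0$. So $g = x^s P(x, y/x)$ is a power series with initial form $y^s$,
  and $g(x, x y) = x^s P$. In the division $p = q g + r$ the blown up remainder has degree less
  than $s$ in $y$ and is divisible by $P$; uniqueness of Weierstrass division gives $r = 0$. This is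
  the only place where factors of a power series have to be constructed.
\<close>

theorem lift_factor_of_transform:
  fixes p h :: "'k::field fps2"
  assumes p: "varX ^ n * p' = blowup p" and "h dvd p'" and h: "y_regular s h"
  obtains g u where "g dvd p" "u dvd 1" "varX ^ s * (u * h) = blowup g"
    "ord2 g = s" "g $ s $ 0 \<noteq> 0" "\<And>i j. i + j \<le> s \<Longrightarrow> j \<noteq> s \<Longrightarrow> g $ j $ i = 0"
proof -
  obtain u P where u: "u dvd 1" "P = u * h" and P: "P $ s = 1"
    "\<And>j. j > s \<Longrightarrow> P $ j = 0" "\<And>j. j < s \<Longrightarrow> P $ j $ 0 = 0"
    using Weierstrass_preparation[OF h] by blast
  have regP: "y_regular s P" using P by (simp add: y_regular_def)
  define g where "g = Abs_fps (\<lambda>j. fps_X ^ (s - j) * P $ j)"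
  have Bg: "varX ^ s * P = blowup g"
  proof (rule fps_ext)
    fix j
    show "(varX ^ s * P) $ j = blowup g $ j"
      using P(2)[of j]
      by (cases "j \<le> s")
        (auto simp: varX_power blowup_nth g_def not_le simp flip: mult.assoc power_add)
  qed
  have g0: "g $ j $ i = 0" if "i + j \<le> s" "j \<noteq> s" for i j
    using that P(3)[of j] by (auto simp: g_def fps_X_power_mult_nth)
  have gs: "g $ s $ 0 = 1" by (simp add: g_def P)
  have regg: "y_regular s g" using g0 gs by (simp add: y_regular_def)
  have ordg: "ord2 g = s" by (rule ord2_eqI[of s g 0 s]) (use g0 gs in auto)
  obtain q r where qr: "p = q * g + r" and r: "fps_shift s r = 0"
    using Weierstrass_division[OF regg] .
  obtain k where k: "p' = k * P"
  proof -
    obtain k where "p' = h * k" using \<open>h dvd p'\<close> by (auto simp: dvd_def)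
    moreover obtain v where "u * v = 1" using u(1) by (metis dvd_def)
    ultimately have "p' = (u * v) * (h * k)" by simp
    then have "p' = k * v * P" by (simp only: u(2) mult_ac)
    then show ?thesis by (rule that)
  qed
  have "blowup r = (varX ^ n * k - varX ^ s * blowup q) * P"
    using p unfolding k qr by (simp add: blowup_add blowup_mult Bg[symmetric] algebra_simps)
  moreover have "fps_shift s (blowup r) = 0"
  proof (rule fps_ext)
    fix j
    have "r $ (j + s) = fps_shift s r $ j" by simp
    then show "fps_shift s (blowup r) $ j = 0 $ j" by (simp add: blowup_nth r)
  qed
  ultimately have "varX ^ n * k - varX ^ s * blowup q = 0"
    using Weierstrass_division_unique[OF regP] by metis
  then have "r = 0" using \<open>blowup r = _\<close> by (simp add: blowup_eq_0_iff)
  then have "g dvd p" using qr by simp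
  show ?thesis
    by (rule that[OF \<open>g dvd p\<close> u(1) _ ordg]) (use Bg u(2) gs g0 in auto)
qed

text \<open>
  A branch has a single tangent. Here it suffices that the two axes are not both tangent to it, that
  is, that its initial form is not divisible by $x y$. Otherwise, after exchanging the variables,
  the transform at the origin would be regular in $y$ of an order $s$ strictly between $0$ and the
  order of $p$. Lifting the transform itself, as a factor of the transform, would give a factor of
  $p$ of order $s$.
\<close>

theorem irreducible_initial_form_not_split:
  fixes p :: "'k::field fps2"
  assumes "irreducible p" and "p $ ord2 p $ 0 = 0" and "p $ 0 $ ord2 p = 0"
  shows False
proof -
  define \<mu> where "\<mu> = ord2 p"
  define p' where "p' = swap p"
  interpret swap: K_automorphism swap swap by (rule K_automorphism_swap)
  have "p \<noteq> 0" using assms(1) by auto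
  have irr: "irreducible p'" using assms(1) by (simp add: p'_def swap.irreducible_iff)
  have ord: "ord2 p' = \<mu>" by (simp add: p'_def \<mu>_def ord2_swap)
  have tr: "varX ^ \<mu> * transform \<mu> p' = blowup p'"
    by (rule varX_power_mult_transform) (use nth_eq_0_of_less_ord2[of _ _ p'] ord in auto)
  obtain i j where ij: "i + j = \<mu>" "p' $ j $ i \<noteq> 0"
    using ord2_witness[of p'] irr ord by (metis irreducible_def)
  then have "transform \<mu> p' $ j $ 0 \<noteq> 0" by (auto simp: transform_nth)
  then obtain s where s: "s \<le> j" "y_regular s (transform \<mu> p')" by (rule y_regular_exists)
  have "p' $ \<mu> $ 0 = 0" "p' $ 0 $ \<mu> = 0" using assms(2,3) by (auto simp: p'_def \<mu>_def)
  have "s \<noteq> 0"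
  proof
    assume "s = 0"
    then show False using s(2) \<open>p' $ 0 $ \<mu> = 0\<close> by (simp add: y_regular_def transform_nth)
  qed
  have "j \<noteq> \<mu>" using \<open>p' $ \<mu> $ 0 = 0\<close> ij by auto
  have "0 < s" "s < \<mu>" using s(1) ij \<open>s \<noteq> 0\<close> \<open>j \<noteq> \<mu>\<close> by auto
  obtain g where g: "g dvd p'" "ord2 g = s"
    using lift_factor_of_transform[OF tr dvd_refl s(2)] by metis
  obtain k where k: "p' = g * k" using g(1) by (auto simp: dvd_def)
  have "g \<noteq> 0" "k \<noteq> 0" using k irr by auto
  then have "ord2 k = \<mu> - s" using ord g(2) by (simp add: k ord2_mult)
  moreover have "g dvd 1 \<or> k dvd 1" using irr k by (auto dest: irreducibleD)
  ultimately show False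
    using \<open>0 < s\<close> \<open>s < \<mu>\<close> ord2_eq_0_iff[OF \<open>g \<noteq> 0\<close>] ord2_eq_0_iff[OF \<open>k \<noteq> 0\<close>] g(2) by auto
qed

section \<open>Branches of the quadratic transform\<close>

text \<open>
  The initial form of $f$ is $c y^n$ with $c \<noteq> 0$: the curve has multiplicity $n$, and its
  only tangent is the $x$-axis.
\<close>

definition horizontal :: "nat \<Rightarrow> 'k::zero fps2 \<Rightarrow> bool" where
  "horizontal n f \<longleftrightarrow> f $ n $ 0 \<noteq> 0 \<and> (\<forall>i j. i + j \<le> n \<longrightarrow> j \<noteq> n \<longrightarrow> f $ j $ i = 0)"

lemma horizontal_ord2: "horizontal n f \<Longrightarrow> ord2 f = n"
  by (rule ord2_eqI[of n f 0 n]) (auto simp: horizontal_def)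

lemma horizontal_nonzero: "horizontal n f \<Longrightarrow> f \<noteq> 0"
  by (auto simp: horizontal_def)

lemma horizontal_y_regular: "horizontal n f \<Longrightarrow> y_regular n f"
  by (auto simp: horizontal_def y_regular_def)

text \<open>
  On the line $x = 0$ the transform is the initial form of $f$ at $(1, y)$, a polynomial of degree at
  most $n$.
\<close>

lemma horizontal_iff:
  "horizontal n f \<longleftrightarrow> (\<forall>i j. i + j < n \<longrightarrow> f $ j $ i = 0) \<and> y_regular n (transform n f)"
proof (intro iffI conjI)
  assume *: "(\<forall>i j. i + j < n \<longrightarrow> f $ j $ i = 0) \<and> y_regular n (transform n f)"
  have "f $ j $ i = 0" if "i + j = n" "j \<noteq> n" for i j
  proof -
    have "transform n f $ j $ 0 = 0" using * that by (auto simp: y_regular_def)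
    moreover have "i = n - j" using that by simp
    ultimately show ?thesis using that by (simp add: transform_nth)
  qed
  then show "horizontal n f"
    using * unfolding horizontal_def by (auto simp: y_regular_def transform_nth le_less)
qed (auto simp: horizontal_def y_regular_def transform_nth)

lemma horizontal_transform_y_regular: "horizontal n f \<Longrightarrow> y_regular n (transform n f)"
  by (simp add: horizontal_iff)

lemma horizontal_transform: "horizontal n f \<Longrightarrow> varX ^ n * transform n f = blowup f"
  by (rule varX_power_mult_transform) (auto simp: horizontal_def)

lemma ord2_transform_le:
  assumes "horizontal n f"
  shows "ord2 (transform n f) \<le> n"
proof -
  have "transform n f $ n $ 0 \<noteq> 0"
    using horizontal_transform_y_regular[OF assms] by (simp add: y_regular_def)
  from ord2_leI[OF this] show ?thesis by simp
qed

lemma horizontal_transform_not_unit: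
  fixes f :: "'k::field fps2"
  assumes "horizontal n f" "n > 0"
  shows "\<not> transform n f dvd 1" "transform n f \<noteq> 0"
  using horizontal_transform_y_regular[OF assms(1)] assms(2)
  by (auto simp: is_unit_fps2_iff y_regular_def)

lemma transform_mult:
  fixes f g :: "'k::field fps2"
  shows "transform (ord2 f + ord2 g) (f * g) = transform (ord2 f) f * transform (ord2 g) g"
proof (rule transform_eqI)
  have *: "blowup f = varX ^ ord2 f * transform (ord2 f) f"
    "blowup g = varX ^ ord2 g * transform (ord2 g) g"
    by (auto intro!: sym intro!: varX_power_mult_transform nth_eq_0_of_less_ord2)
  show "varX ^ (ord2 f + ord2 g) * (transform (ord2 f) f * transform (ord2 g) g) =
      blowup (f * g)"
    by (simp only: blowup_mult * power_add mult_ac)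
qed

text \<open>
  Factors of a power of $y$ are powers of $y$. For each factor, the order is at most the order of its
  restriction to $x = 0$, and at least the order on $x = 0$ of its transform. In each of the three
  cases the numbers for the two factors add up to $n$, so all these inequalities are equalities.
\<close>

lemma horizontal_mult:
  fixes f g :: "'k::field fps2"
  assumes "horizontal n (f * g)"
  shows "n = ord2 f + ord2 g" "horizontal (ord2 f) f" "horizontal (ord2 g) g"
    "transform n (f * g) = transform (ord2 f) f * transform (ord2 g) g"
proof -
  have nz: "f \<noteq> 0" "g \<noteq> 0" using horizontal_nonzero[OF assms] by auto
  show n: "n = ord2 f + ord2 g" using horizontal_ord2[OF assms] nz by (simp add: ord2_mult)
  show t: "transform n (f * g) = transform (ord2 f) f * transform (ord2 g) g"
    by (simp add: n transform_mult)
  have reg: "y_regular n (f * g)" using assms by (rule horizontal_y_regular)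
  obtain s where s: "y_regular s f" using y_regular_dvd[OF reg, of f] by auto
  obtain t where t: "y_regular t g" using y_regular_dvd[OF reg, of g] by auto
  have "s + t = n" using y_regular_unique[OF y_regular_mult[OF s t] reg] .
  moreover have "ord2 f \<le> s" "ord2 g \<le> t"
    using ord2_leI[of f s 0] ord2_leI[of g t 0] s t by (auto simp: y_regular_def)
  ultimately have st: "ord2 f = s" "ord2 g = t" using n by auto
  have reg': "y_regular n (transform (ord2 f) f * transform (ord2 g) g)"
    using horizontal_transform_y_regular[OF assms]
    by (simp only: \<open>transform n (f * g) = _\<close>)
  obtain j where j: "y_regular j (transform (ord2 f) f)"
    using y_regular_dvd[OF reg', of "transform (ord2 f) f"] by auto
  obtain k where k: "y_regular k (transform (ord2 g) g)"
    using y_regular_dvd[OF reg', of "transform (ord2 g) g"] by auto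
  have "j + k = n" using y_regular_unique[OF y_regular_mult[OF j k] reg'] .
  moreover have "j \<le> ord2 f"
  proof (rule ccontr)
    assume "\<not> ?thesis"
    then have "transform (ord2 f) f $ ord2 f $ 0 = 0" using j by (simp add: y_regular_def)
    then show False using s st by (simp add: transform_nth y_regular_def)
  qed
  moreover have "k \<le> ord2 g"
  proof (rule ccontr)
    assume "\<not> ?thesis"
    then have "transform (ord2 g) g $ ord2 g $ 0 = 0" using k by (simp add: y_regular_def)
    then show False using t st by (simp add: transform_nth y_regular_def)
  qed
  ultimately have "j = ord2 f" "k = ord2 g" using n by auto
  with j k show "horizontal (ord2 f) f" "horizontal (ord2 g) g"
    by (auto simp: horizontal_iff nth_eq_0_of_less_ord2)
qed

text \<open>
  A proper factor of the transform would lift to a proper factor of $p$.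
\<close>

lemma irreducible_transform:
  fixes p :: "'k::field fps2"
  assumes "irreducible p" "horizontal m p"
  shows "irreducible (transform m p)"
proof (rule irreducibleI)
  have "m > 0" using assms ord2_eq_0_iff[of p] horizontal_ord2[OF assms(2)]
    by (auto simp: irreducible_def)
  then show "transform m p \<noteq> 0" "\<not> transform m p dvd 1"
    using horizontal_transform_not_unit[OF assms(2)] by auto
  fix a b assume ab: "transform m p = a * b"
  have reg: "y_regular m (a * b)"
    using horizontal_transform_y_regular[OF assms(2)] ab by simp
  obtain s where s: "y_regular s a" using y_regular_dvd[OF reg, of a] by auto
  obtain t where t: "y_regular t b" using y_regular_dvd[OF reg, of b] by auto
  have st: "s + t = m" using y_regular_unique[OF y_regular_mult[OF s t] reg] .
  have "a dvd transform m p" by (simp add: ab)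
  then obtain g where g: "g dvd p" "ord2 g = s"
    using lift_factor_of_transform[OF horizontal_transform[OF assms(2)] _ s] by metis
  obtain k where k: "p = g * k" using g(1) by (auto simp: dvd_def)
  have nz: "g \<noteq> 0" "k \<noteq> 0" using k assms(1) by auto
  have "ord2 k = t" using horizontal_ord2[OF assms(2)] g(2) st nz by (simp add: k ord2_mult)
  moreover have "g dvd 1 \<or> k dvd 1" using assms(1) k by (auto dest: irreducibleD)
  ultimately have "s = 0 \<or> t = 0"
    using g(2) ord2_eq_0_iff[OF nz(1)] ord2_eq_0_iff[OF nz(2)] by auto
  then show "a dvd 1 \<or> b dvd 1" using s t by (auto simp: y_regular_0_iff)
qed

lemma branches_horizontal:
  fixes f :: "'k::field fps2"
  assumes "horizontal n f" "p \<in> branches f"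
  shows "irreducible p" "horizontal (ord2 p) p" "ord2 p > 0" "ord2 p \<le> n"
proof -
  obtain k where k: "f = p * k" and "branch p" using assms(2) by (auto simp: branches_def dvd_def)
  then show "irreducible p" by (simp add: branch_iff_irreducible)
  show "horizontal (ord2 p) p" "ord2 p \<le> n" using horizontal_mult[of n p k] assms(1) k by auto
  show "ord2 p > 0" using \<open>branch p\<close> by (auto simp: branch_def algebroid_curve_iff_ord2)
qed

lemma transform_branch:
  fixes f :: "'k::field fps2"
  assumes "horizontal n f" "p \<in> branches f"
  shows "transform (ord2 p) p \<in> branches (transform n f)"
proof -
  obtain k where k: "f = p * k" using assms(2) by (auto simp: branches_def dvd_def)
  then have "transform (ord2 p) p dvd transform n f"
    using horizontal_mult(4)[of n p k] assms(1) by simp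
  moreover have "irreducible (transform (ord2 p) p)"
    using branches_horizontal[OF assms] by (intro irreducible_transform)
  ultimately show ?thesis by (simp add: branches_def branch_iff_irreducible)
qed

text \<open>
  The branch $h$ lifts to a factor of $f$. A factorization of the lift transforms into one of $h$,
  and a transform is a unit only if the series has order $0$; so the lift is irreducible.
\<close>

lemma branch_of_transform:
  fixes f :: "'k::field fps2"
  assumes "horizontal n f" "h \<in> branches (transform n f)"
  obtains p u where "p \<in> branches f" "u dvd 1" "transform (ord2 p) p = u * h"
proof -
  have h: "irreducible h" "h dvd transform n f"
    using assms(2) by (auto simp: branches_def branch_iff_irreducible)
  obtain s where s: "y_regular s h"
    using y_regular_dvd[OF horizontal_transform_y_regular[OF assms(1)] h(2)] by auto
  obtain g u where g: "g dvd f" "u dvd 1" "varX ^ s * (u * h) = blowup g" "ord2 g = s"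
    and "g $ s $ 0 \<noteq> 0" "\<And>i j. i + j \<le> s \<Longrightarrow> j \<noteq> s \<Longrightarrow> g $ j $ i = 0"
    by (rule lift_factor_of_transform[OF horizontal_transform[OF assms(1)] h(2) s]) blast
  then have hor: "horizontal s g" by (simp add: horizontal_def)
  have tg: "transform s g = u * h" using g(3) by (rule transform_eqI)
  have "irreducible g"
  proof (rule irreducibleI)
    show "g \<noteq> 0" using hor by (rule horizontal_nonzero)
    show "\<not> g dvd 1"
    proof
      assume "g dvd 1"
      then have "s = 0" using ord2_eq_0_iff[OF \<open>g \<noteq> 0\<close>] g(4) by simp
      then show False using s h(1) by (auto simp: y_regular_0_iff irreducible_def)
    qed
  next
    fix a b assume ab: "g = a * b"
    note ab' = horizontal_mult[of s a b, folded ab, OF hor]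
    obtain v where v: "u * v = 1" using g(2) by (metis dvd_def)
    have "h = (u * v) * h" using v by simp
    also have "\<dots> = transform s g * v" unfolding tg by (simp only: mult_ac)
    finally have "h = transform (ord2 a) a * (transform (ord2 b) b * v)"
      unfolding ab'(4) by (simp only: mult.assoc)
    then have "transform (ord2 a) a dvd 1 \<or> transform (ord2 b) b * v dvd 1"
      using h(1) by (auto dest: irreducibleD)
    then have "transform (ord2 a) a dvd 1 \<or> transform (ord2 b) b dvd 1"
      by (meson dvd_mult_left)
    then have "ord2 a = 0 \<or> ord2 b = 0"
      using horizontal_transform_not_unit(1)[OF ab'(2)] horizontal_transform_not_unit(1)[OF ab'(3)]
      by blast
    then show "a dvd 1 \<or> b dvd 1"
      using ord2_eq_0_iff[of a] ord2_eq_0_iff[of b] ab \<open>irreducible h\<close> hor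
        horizontal_nonzero[OF hor] by auto
  qed
  then have "g \<in> branches f" using g(1) by (simp add: branches_def branch_iff_irreducible)
  with g(2) tg g(4) show ?thesis by (intro that) auto
qed

section \<open>Intersection with a smooth curve\<close>

definition graph :: "'k::comm_ring_1 fps \<Rightarrow> 'k fps2" where
  "graph \<phi> = fps_X - fps_const \<phi>"

text \<open>
  The series $p(x, \<phi>(x))$ for $\<phi>$ without constant term. Then $\<phi>^j$ has order at
  least $j$, so only the terms with $j \<le> k$ contribute to the coefficient of $x^k$.
\<close>

definition restriction :: "'k::comm_ring_1 fps \<Rightarrow> 'k fps2 \<Rightarrow> 'k fps" where
  "restriction \<phi> p = Abs_fps (\<lambda>k. \<Sum>j\<le>k. (p $ j * \<phi> ^ j) $ k)"

lemma mult_power_nth_eq_0: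
  fixes \<phi> :: "'k::field fps"
  assumes "\<phi> $ 0 = 0" "k < j"
  shows "(a * \<phi> ^ j) $ k = 0"
  using assms by (auto simp: fps_mult_nth startsby_zero_power_prefix intro!: sum.neutral)

lemma restriction_nth:
  fixes \<phi> :: "'k::field fps"
  assumes "\<phi> $ 0 = 0" "k \<le> N"
  shows "restriction \<phi> p $ k = (\<Sum>j\<le>N. (p $ j * \<phi> ^ j) $ k)"
  using assms mult_power_nth_eq_0[OF assms(1)]
  by (simp add: restriction_def) (intro sum.mono_neutral_left; auto)

lemma restriction_rec:
  fixes \<phi> :: "'k::field fps"
  assumes "\<phi> $ 0 = 0"
  shows "restriction \<phi> p = p $ 0 + \<phi> * restriction \<phi> (fps_shift 1 p)"
proof (rule fps_ext)
  fix k
  have "restriction \<phi> p $ k = (\<Sum>j\<le>Suc k. (p $ j * \<phi> ^ j) $ k)"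
    by (rule restriction_nth[OF assms]) simp
  also have "\<dots> = p $ 0 $ k + (\<Sum>j\<le>k. (p $ Suc j * \<phi> ^ Suc j) $ k)"
    by (subst sum.atMost_Suc_shift) simp
  also have "(\<Sum>j\<le>k. (p $ Suc j * \<phi> ^ Suc j) $ k) =
      (\<Sum>j\<le>k. \<Sum>i=0..k. \<phi> $ i * (p $ Suc j * \<phi> ^ j) $ (k - i))"
    by (simp only: power_Suc mult.left_commute[of _ \<phi>] fps_mult_nth[of \<phi>])
  also have "\<dots> = (\<Sum>i=0..k. \<Sum>j\<le>k. \<phi> $ i * (p $ Suc j * \<phi> ^ j) $ (k - i))"
    by (rule sum.swap)
  also have "\<dots> = (\<phi> * restriction \<phi> (fps_shift 1 p)) $ k"
    by (simp add: fps_mult_nth[of \<phi>] restriction_nth[OF assms, of _ k] sum_distrib_left)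
  finally show "restriction \<phi> p $ k = (p $ 0 + \<phi> * restriction \<phi> (fps_shift 1 p)) $ k" by simp
qed

lemma y_regular_graph: "\<phi> $ 0 = 0 \<Longrightarrow> y_regular 1 (graph \<phi> :: 'k::field fps2)"
  by (simp add: y_regular_def graph_def)

text \<open>
  The quotient has the coefficients $q_i = \sum_{j>i} p_j \<phi>^{j-1-i}$, as in Horner's scheme.
\<close>

lemma divide_by_graph:
  fixes \<phi> :: "'k::field fps"
  assumes "\<phi> $ 0 = 0"
  obtains q where "p = q * graph \<phi> + fps_const (restriction \<phi> p)"
proof
  define q where "q = Abs_fps (\<lambda>i. restriction \<phi> (fps_shift (Suc i) p))"
  show "p = q * graph \<phi> + fps_const (restriction \<phi> p)"
  proof (rule fps_ext)
    fix i
    show "p $ i = (q * graph \<phi> + fps_const (restriction \<phi> p)) $ i"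
    proof (cases i)
      case 0
      then show ?thesis
        using restriction_rec[OF assms, of p] by (simp add: graph_def right_diff_distrib q_def mult.commute)
    next
      case (Suc m)
      have shift: "fps_shift (Suc 0) (fps_shift (Suc m) p) = fps_shift (Suc (Suc m)) p"
        by (rule fps_ext) simp
      have "restriction \<phi> (fps_shift (Suc m) p) =
          p $ Suc m + \<phi> * restriction \<phi> (fps_shift (Suc (Suc m)) p)"
        using restriction_rec[OF assms, of "fps_shift (Suc m) p"]
        by (simp add: shift)
      then show ?thesis using Suc
        by (simp add: graph_def right_diff_distrib q_def mult.commute[of \<phi>])
    qed
  qed
qed

lemma restriction_eqI:
  fixes \<phi> :: "'k::field fps"
  assumes "\<phi> $ 0 = 0" "p = q * graph \<phi> + fps_const r"
  shows "restriction \<phi> p = r"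
proof -
  obtain q' where q': "p = q' * graph \<phi> + fps_const (restriction \<phi> p)"
    using divide_by_graph[OF assms(1)] .
  have "q' * graph \<phi> + fps_const (restriction \<phi> p) = q * graph \<phi> + fps_const r"
    using q' assms(2) by simp
  then have *: "(q - q') * graph \<phi> = fps_const (restriction \<phi> p - r)"
    by (simp add: algebra_simps flip: fps_const_sub)
  have "fps_shift 1 ((q - q') * graph \<phi>) = 0"
    unfolding * by (rule fps_ext) simp
  then have "q - q' = 0"
    by (rule Weierstrass_division_unique[OF y_regular_graph[OF assms(1)]])
  then show ?thesis using * by simp
qed

lemma restriction_fps_const: "\<phi> $ 0 = 0 \<Longrightarrow> restriction \<phi> (fps_const r) = (r :: 'k::field fps)"
  by (rule restriction_eqI[of _ _ 0]) simp_all

lemma restriction_mult: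
  fixes \<phi> :: "'k::field fps"
  assumes "\<phi> $ 0 = 0"
  shows "restriction \<phi> (f * g) = restriction \<phi> f * restriction \<phi> g"
proof -
  obtain q where q: "f = q * graph \<phi> + fps_const (restriction \<phi> f)"
    using divide_by_graph[OF assms] .
  obtain q' where q': "g = q' * graph \<phi> + fps_const (restriction \<phi> g)"
    using divide_by_graph[OF assms] .
  define a b where "a = fps_const (restriction \<phi> f)" and "b = fps_const (restriction \<phi> g)"
  have "f * g = (q * graph \<phi> + a) * (q' * graph \<phi> + b)"
    using q q' by (simp add: a_def b_def)
  also have "\<dots> = (q * (q' * graph \<phi> + b) + a * q') * graph \<phi> + a * b"
    by (simp add: algebra_simps)
  also have "a * b = fps_const (restriction \<phi> f * restriction \<phi> g)" by (simp add: a_def b_def)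
  finally show ?thesis by (rule restriction_eqI[OF assms])
qed

lemma restriction_add:
  fixes \<phi> :: "'k::field fps"
  shows "restriction \<phi> (f + g) = restriction \<phi> f + restriction \<phi> g"
  by (rule fps_ext) (simp add: restriction_def distrib_right sum.distrib)

lemma restriction_sum:
  fixes \<phi> :: "'k::field fps"
  shows "restriction \<phi> (\<Sum>x\<in>A. F x) = (\<Sum>x\<in>A. restriction \<phi> (F x))"
proof (induction A rule: infinite_finite_induct)
  have "restriction \<phi> 0 = 0" by (rule fps_ext) (simp add: restriction_def)
  then show "restriction \<phi> (\<Sum>x\<in>A. F x) = (\<Sum>x\<in>A. restriction \<phi> (F x))" if "infinite A" for A
    using that by simp
  show "restriction \<phi> (\<Sum>x\<in>{}. F x) = (\<Sum>x\<in>{}. restriction \<phi> (F x))"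
    using \<open>restriction \<phi> 0 = 0\<close> by simp
qed (simp add: restriction_add)

lemma restriction_graph: "\<phi> $ 0 = 0 \<Longrightarrow> restriction \<phi> (graph \<phi>) = (0 :: 'k::field fps)"
  by (rule restriction_eqI[of _ _ 1]) simp_all

text \<open>
  Restriction to the curve $y = \<phi>(x)$ identifies $K[[x,y]]/(y - \<phi>)$ with $K[[x]]$.
\<close>

lemma ideal2_graph_iff:
  fixes \<phi> :: "'k::field fps"
  assumes \<phi>: "\<phi> $ 0 = 0" and u: "u dvd 1"
  shows "h \<in> ideal2 p (u * graph \<phi>) \<longleftrightarrow> restriction \<phi> p dvd restriction \<phi> h"
proof
  assume "h \<in> ideal2 p (u * graph \<phi>)"
  then obtain a b where "h = a * p + b * (u * graph \<phi>)" by (auto simp: ideal2_def)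
  then show "restriction \<phi> p dvd restriction \<phi> h"
    by (simp add: restriction_add restriction_mult[OF \<phi>] restriction_graph[OF \<phi>])
next
  assume "restriction \<phi> p dvd restriction \<phi> h"
  then obtain k where k: "restriction \<phi> h = restriction \<phi> p * k" by (auto simp: dvd_def)
  obtain q where q: "p = q * graph \<phi> + fps_const (restriction \<phi> p)"
    using divide_by_graph[OF \<phi>] .
  obtain q' where q': "h = q' * graph \<phi> + fps_const (restriction \<phi> h)"
    using divide_by_graph[OF \<phi>] .
  obtain v where v: "u * v = 1" using u by (metis dvd_def)
  have "fps_const (restriction \<phi> h) = fps_const k * fps_const (restriction \<phi> p)"
    by (simp add: k mult.commute)
  also have "fps_const (restriction \<phi> p) = p - q * graph \<phi>" using q by (simp add: algebra_simps)
  finally have "h = q' * graph \<phi> + fps_const k * (p - q * graph \<phi>)" using q' by simp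
  then have "h = fps_const k * p + (q' - fps_const k * q) * graph \<phi>"
    by (simp only: algebra_simps)
  also have "graph \<phi> = (u * v) * graph \<phi>" by (simp add: v)
  also have "\<dots> = v * (u * graph \<phi>)" by (simp only: mult_ac)
  finally have "h = fps_const k * p + ((q' - fps_const k * q) * v) * (u * graph \<phi>)"
    by (simp only: mult.assoc)
  then show "h \<in> ideal2 p (u * graph \<phi>)" unfolding ideal2_def by blast
qed

lemma fps_X_power_dvd_iff: "fps_X ^ n dvd (r :: 'k::field fps) \<longleftrightarrow> (\<forall>i<n. r $ i = 0)"
proof
  assume "\<forall>i<n. r $ i = 0"
  then have "r = fps_X ^ n * fps_shift n r" by (auto simp: fps_eq_iff fps_X_power_mult_nth)
  then show "fps_X ^ n dvd r" by (rule dvdI)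
qed (auto simp: dvd_def fps_X_power_mult_nth)

lemma inj_const_fps_X_power: "inj_on (\<lambda>i. fps_const (fps_X ^ i) :: 'k::field fps2) A"
proof (rule inj_onI)
  fix i j assume "fps_const (fps_X ^ i) = (fps_const (fps_X ^ j) :: 'k fps2)"
  then have "fps_const (fps_X ^ i) $ 0 = (fps_const (fps_X ^ j) :: 'k fps2) $ 0" by simp
  then have "fps_X ^ i = (fps_X ^ j :: 'k fps)" by simp
  then show "i = j" by (metis fps_X_power_subdegree)
qed

text \<open>
  The first $N$ coefficients of the restriction to $y = \<phi>(x)$ define a linear map onto $K^N$
  that vanishes on the ideal, so a finite set generating the quotient has at least $N$ elements.
\<close>

lemma quotient_basis_card_ge:
  fixes \<phi> :: "'k::field fps"
  assumes \<phi>: "\<phi> $ 0 = 0" and u: "u dvd 1" and N: "fps_X ^ N dvd restriction \<phi> p"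
    and B: "quotient_basis (ideal2 p (u * graph \<phi>)) B"
  shows "N \<le> card B"
proof -
  interpret V: vector_space "\<lambda>c f. fps_const c * (f :: 'k fps)"
    by standard (simp_all add: algebra_simps flip: fps_const_add)
  define L where "L h = fps_cutoff N (restriction \<phi> h)" for h
  have finB: "finite B" using B by (simp add: quotient_basis_def)
  have const2: "restriction \<phi> (const2 c) = fps_const c" for c
    by (simp add: const2_def restriction_fps_const[OF \<phi>])
  have L_sum: "L (\<Sum>b\<in>B. const2 (c b) * b) = (\<Sum>b\<in>B. fps_const (c b) * L b)" for c
  proof (rule fps_ext)
    fix i
    show "L (\<Sum>b\<in>B. const2 (c b) * b) $ i = (\<Sum>b\<in>B. fps_const (c b) * L b) $ i"
      by (simp add: L_def restriction_sum restriction_mult[OF \<phi>] const2 fps_sum_nth)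
  qed
  have L_ideal: "L x = L y" if "x - y \<in> ideal2 p (u * graph \<phi>)" for x y
  proof -
    have "restriction \<phi> p dvd restriction \<phi> (x - y)"
      using that ideal2_graph_iff[OF \<phi> u] by blast
    then have "fps_X ^ N dvd restriction \<phi> (x - y)" using N by (rule dvd_trans[rotated])
    then have "restriction \<phi> (x - y) $ i = 0" if "i < N" for i
      using that by (simp add: fps_X_power_dvd_iff)
    moreover have "restriction \<phi> x = restriction \<phi> (x - y) + restriction \<phi> y"
      using restriction_add[of \<phi> "x - y" y] by simp
    ultimately show ?thesis by (simp add: L_def fps_eq_iff)
  qed
  let ?S = "(\<lambda>i. fps_X ^ i) ` {..<N} :: 'k fps set"
  have inj: "inj_on (\<lambda>i. fps_X ^ i :: 'k fps) A" for A
    by (rule inj_onI) (metis fps_X_power_subdegree)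
  have "?S \<subseteq> V.span (L ` B)"
  proof safe
    fix i assume "i < N"
    obtain c where "fps_const (fps_X ^ i) - (\<Sum>b\<in>B. const2 (c b) * b) \<in> ideal2 p (u * graph \<phi>)"
      using B unfolding quotient_basis_def by blast
    then have "L (fps_const (fps_X ^ i)) = (\<Sum>b\<in>B. fps_const (c b) * L b)"
      using L_ideal L_sum by metis
    moreover have "L (fps_const (fps_X ^ i)) = fps_X ^ i"
      using \<open>i < N\<close> by (simp add: L_def restriction_fps_const[OF \<phi>] fps_eq_iff)
    moreover have "(\<Sum>b\<in>B. fps_const (c b) * L b) \<in> V.span (L ` B)"
      by (intro V.span_sum V.span_scale V.span_base imageI)
    ultimately show "fps_X ^ i \<in> V.span (L ` B)" by metis
  qed
  moreover have "V.independent ?S"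
  proof (rule V.independent_if_scalars_zero)
    fix c x assume 0: "(\<Sum>x\<in>?S. fps_const (c x) * x) = 0" and "x \<in> ?S"
    then obtain i where i: "i < N" "x = fps_X ^ i" by auto
    have "0 = (\<Sum>j<N. fps_const (c (fps_X ^ j)) * fps_X ^ j) $ i"
      using 0 by (simp add: sum.reindex[OF inj])
    also have "\<dots> = (\<Sum>j<N. if j = i then c (fps_X ^ j) else 0)"
      by (auto simp: fps_sum_nth intro!: sum.cong simp del: sum.delta sum.delta')
    also have "\<dots> = c x" using i by simp
    finally show "c x = 0" ..
  qed simp
  ultimately have "card ?S \<le> card (L ` B)"
    using V.independent_span_bound[of "L ` B" ?S] finB by simp
  also have "\<dots> \<le> card B" using finB by (rule card_image_le)
  finally show ?thesis by (simp add: card_image[OF inj])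
qed

lemma quotient_basis_powers:
  fixes \<phi> :: "'k::field fps"
  assumes \<phi>: "\<phi> $ 0 = 0" and u: "u dvd 1" and nz: "restriction \<phi> p \<noteq> 0"
  defines "N \<equiv> subdegree (restriction \<phi> p)"
  shows "quotient_basis (ideal2 p (u * graph \<phi>)) ((\<lambda>i. fps_const (fps_X ^ i)) ` {..<N})"
proof -
  let ?B = "(\<lambda>i. fps_const (fps_X ^ i) :: 'k fps2) ` {..<N}"
  have const2: "restriction \<phi> (const2 c) = fps_const c" for c
    by (simp add: const2_def restriction_fps_const[OF \<phi>])
  have inj: "inj_on (\<lambda>i. fps_const (fps_X ^ i) :: 'k fps2) A" for A
    by (rule inj_const_fps_X_power)
  have dvd: "restriction \<phi> p dvd r \<longleftrightarrow> (\<forall>i<N. r $ i = 0)" for r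
  proof -
    have "restriction \<phi> p dvd r \<longleftrightarrow> fps_X ^ N dvd r"
      using subdegree_decompose[of "restriction \<phi> p"] nz by (auto simp: N_def fps_dvd_iff)
    then show ?thesis by (simp add: fps_X_power_dvd_iff)
  qed
  have comb: "restriction \<phi> (\<Sum>b\<in>?B. const2 (c b) * b) $ i =
      (if i < N then c (fps_const (fps_X ^ i)) else 0)" for c i
  proof -
    have "restriction \<phi> (\<Sum>b\<in>?B. const2 (c b) * b) =
        (\<Sum>j<N. fps_const (c (fps_const (fps_X ^ j))) * fps_X ^ j)"
      by (simp add: sum.reindex[OF inj] restriction_sum restriction_mult[OF \<phi>] const2
          restriction_fps_const[OF \<phi>])
    also have "\<dots> $ i = (\<Sum>j<N. if j = i then c (fps_const (fps_X ^ j)) else 0)"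
      by (auto simp: fps_sum_nth intro!: sum.cong simp del: sum.delta sum.delta')
    finally show ?thesis by simp
  qed
  show ?thesis unfolding quotient_basis_def
  proof (intro conjI allI impI ballI)
    fix c and b :: "'k fps2"
    assume "(\<Sum>b\<in>?B. const2 (c b) * b) \<in> ideal2 p (u * graph \<phi>)"
      and "b \<in> ?B"
    then show "c b = 0" unfolding ideal2_graph_iff[OF \<phi> u] dvd comb by auto
  next
    fix h :: "'k fps2"
    \<comment> \<open>the exponent $i$ is recovered from the basis element $x^i$\<close>
    define c where "c b = restriction \<phi> h $ subdegree (b $ 0)" for b :: "'k fps2"
    have "restriction \<phi> (h - S) = restriction \<phi> h - restriction \<phi> S" for S
      using restriction_add[of \<phi> "h - S" S] by simp
    then show "\<exists>c. h - (\<Sum>b\<in>?B. const2 (c b) * b)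
        \<in> ideal2 p (u * graph \<phi>)"
      unfolding ideal2_graph_iff[OF \<phi> u] dvd
      by (intro exI[of _ c]) (simp add: comb, simp add: c_def fps_X_power_subdegree)
  qed simp
qed

text \<open>
  The quotient is $K[[x]]/(r)$ with $r = p(x, \<phi>(x))$, of dimension the order of $r$.
\<close>

theorem intersection_mult_graph:
  fixes \<phi> :: "'k::field fps"
  assumes \<phi>: "\<phi> $ 0 = 0" and u: "u dvd 1"
  shows "intersection_mult p (u * graph \<phi>) =
    (if restriction \<phi> p = 0 then \<infinity> else enat (subdegree (restriction \<phi> p)))"
proof (cases "restriction \<phi> p = 0")
  case True
  have "\<not> quotient_basis (ideal2 p (u * graph \<phi>)) B" for B
    using quotient_basis_card_ge[OF \<phi> u, of "Suc (card B)" p B] True by auto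
  then show ?thesis using True by (simp add: intersection_mult_def quotient_dim_def top_enat_def)
next
  case False
  let ?N = "subdegree (restriction \<phi> p)" and ?B = "(\<lambda>i. fps_const (fps_X ^ i) :: 'k fps2)"
  have "inj_on ?B {..<?N}"
    by (rule inj_const_fps_X_power)
  then have card: "card (?B ` {..<?N}) = ?N" by (simp add: card_image)
  have "intersection_mult p (u * graph \<phi>) = enat ?N"
    unfolding intersection_mult_def quotient_dim_def
  proof (rule antisym)
    show "(INF B\<in>{B. quotient_basis (ideal2 p (u * graph \<phi>)) B}. enat (card B)) \<le> enat ?N"
      by (rule INF_lower2[of "?B ` {..<?N}"]) (simp_all add: card quotient_basis_powers[OF \<phi> u False])
    have "fps_X ^ ?N dvd restriction \<phi> p" by (auto simp: fps_X_power_dvd_iff)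
    then show "enat ?N \<le> (INF B\<in>{B. quotient_basis (ideal2 p (u * graph \<phi>)) B}. enat (card B))"
      using quotient_basis_card_ge[OF \<phi> u] by (auto intro!: INF_greatest)
  qed
  then show ?thesis using False by simp
qed

section \<open>Contact with smooth curves\<close>

lemma ideal2_unit_right:
  fixes u :: "'k::field fps2"
  assumes "u dvd 1"
  shows "ideal2 p (u * w) = ideal2 p w"
proof -
  obtain v where v: "u * v = 1" using assms by (metis dvd_def)
  have "a * p + b * w = a * p + (b * v) * (u * w)" for a b
  proof -
    have "(b * v) * (u * w) = b * ((u * v) * w)" by (simp only: mult_ac)
    then show ?thesis by (simp add: v)
  qed
  moreover have "a * p + b * (u * w) = a * p + (b * u) * w" for a b
    by (simp only: mult.assoc)
  ultimately show ?thesis unfolding ideal2_def by blast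
qed

lemma ideal2_commute: "ideal2 f g = ideal2 g f"
  unfolding ideal2_def by (metis add.commute)

lemma intersection_mult_unit_right:
  "u dvd 1 \<Longrightarrow> intersection_mult p (u * w) = intersection_mult p w"
  by (simp add: intersection_mult_def ideal2_unit_right)

lemma intersection_mult_unit_left:
  "u dvd 1 \<Longrightarrow> intersection_mult (u * p) w = intersection_mult p w"
  by (simp add: intersection_mult_def ideal2_commute[of _ w] ideal2_unit_right)

lemma ord2_unit_mult:
  fixes u :: "'k::field fps2"
  assumes "u dvd 1"
  shows "ord2 (u * f) = ord2 f"
proof (cases "f = 0")
  case False
  have "u \<noteq> 0" using assms by auto
  then show ?thesis using assms False ord2_eq_0_iff[of u] by (simp add: ord2_mult)
qed simp

lemma branch_contact_unit:
  fixes u :: "'k::field fps2"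
  assumes "u dvd 1"
  shows "branch_contact (u * p) w = branch_contact p w" "branch_contact p (u * w) = branch_contact p w"
  using assms
  by (simp_all add: branch_contact_def curve_mult_def ord2_unit_mult intersection_mult_unit_left
      intersection_mult_unit_right)

text \<open>
  A smooth curve is irreducible, hence up to units it is its own and only branch.
\<close>

lemma contact_smooth:
  fixes f w :: "'k::field fps2"
  assumes "smooth_curve w"
  shows "contact f w = (INF p\<in>branches f. branch_contact p w)"
proof -
  have irr: "irreducible w" using assms by (rule smooth_curve_irreducible)
  then have w: "w \<in> branches w" by (simp add: branches_def branch_iff_irreducible)
  have same: "branch_contact p g = branch_contact p w" if "g \<in> branches w" for p g
  proof -
    have "irreducible g" "g dvd w" using that by (auto simp: branches_def branch_iff_irreducible)
    then obtain k where k: "w = g * k" and "\<not> g dvd 1" by (auto simp: irreducible_def elim!: dvdE)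
    then have "k dvd 1" using irr by (auto dest: irreducibleD)
    then show ?thesis by (simp add: k mult.commute[of g] branch_contact_unit)
  qed
  show ?thesis unfolding contact_def
  proof (rule antisym)
    show "(INF (p, q)\<in>branches f \<times> branches w. branch_contact p q) \<le>
        (INF p\<in>branches f. branch_contact p w)"
      using w by (intro INF_mono) (auto intro!: bexI)
    show "(INF p\<in>branches f. branch_contact p w) \<le>
        (INF (p, q)\<in>branches f \<times> branches w. branch_contact p q)"
      by (rule INF_mono) (auto simp: same)
  qed
qed

lemma smooth_curve_unit:
  fixes u :: "'k::field fps2"
  assumes "u dvd 1"
  shows "smooth_curve (u * w) \<longleftrightarrow> smooth_curve w"
  using assms by (auto simp: smooth_curve_iff_ord2 ord2_unit_mult)

lemma contact_unit_right:
  fixes u w :: "'k::field fps2"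
  assumes "u dvd 1" "smooth_curve w"
  shows "contact f (u * w) = contact f w"
  using assms by (simp add: contact_smooth smooth_curve_unit branch_contact_unit)

lemma branch_contact_smooth:
  "smooth_curve w \<Longrightarrow>
    branch_contact p w = ereal_of_enat (intersection_mult p w) / ereal (real (ord2 p))"
  by (simp add: branch_contact_def smooth_curve_def curve_mult_def)

lemma branch_contact_ge_iff:
  fixes w p :: "'k::field fps2"
  assumes "smooth_curve w" "ord2 p > 0"
  shows "ereal (real k) \<le> branch_contact p w \<longleftrightarrow> enat (k * ord2 p) \<le> intersection_mult p w"
proof (cases "intersection_mult p w")
  case (enat e)
  have "real k \<le> real e / real (ord2 p) \<longleftrightarrow> real (k * ord2 p) \<le> real e"
    using assms(2) by (simp add: field_simps)
  also have "\<dots> \<longleftrightarrow> k * ord2 p \<le> e" by (simp only: of_nat_le_iff)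
  finally show ?thesis
    using enat assms(2) by (simp add: branch_contact_smooth[OF assms(1)])
next
  case infinity
  then show ?thesis using assms(2) by (simp add: branch_contact_smooth[OF assms(1)])
qed

lemma branch_contact_eq_1:
  fixes w p :: "'k::field fps2"
  assumes "smooth_curve w" "ord2 p > 0" "intersection_mult p w = enat (ord2 p)"
  shows "branch_contact p w = 1"
  using assms by (simp add: branch_contact_smooth one_ereal_def)

lemma branch_contact_nonneg: "0 \<le> branch_contact p w"
  unfolding branch_contact_def
  by (cases "intersection_mult p w"; cases "curve_mult p * curve_mult w = 0")
    (auto simp: ereal_divide_eq)

subsection \<open>Smooth curves as graphs\<close>

text \<open>
  Weierstrass preparation in degree $1$, which is the implicit function theorem.
\<close>

lemma smooth_curve_graph:
  fixes w :: "'k::field fps2"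
  assumes "smooth_curve w" "w $ 1 $ 0 \<noteq> 0"
  obtains u \<phi> where "u dvd 1" "\<phi> $ 0 = 0" "w = u * graph \<phi>"
proof -
  have "w $ 0 $ 0 = 0" using assms(1) nth_eq_0_of_less_ord2[of 0 0 w] by (simp add: smooth_curve_iff_ord2)
  then have "y_regular 1 w" using assms(2) by (simp add: y_regular_def)
  then obtain u P where u: "u dvd 1" "P = u * w" and P: "P $ 1 = 1"
      "\<And>j. j > 1 \<Longrightarrow> P $ j = 0" "\<And>j. j < 1 \<Longrightarrow> P $ j $ 0 = 0"
    by (rule Weierstrass_preparation) blast
  have "P = graph (- (P $ 0))"
  proof (rule fps_ext)
    fix j
    show "P $ j = graph (- (P $ 0)) $ j"
      using P(1) P(2)[of j] by (cases "j = 0"; cases "j = 1") (auto simp: graph_def)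
  qed
  moreover obtain v where v: "u * v = 1" using u(1) by (metis dvd_def)
  have "v * P = (u * v) * w" unfolding u(2) by (simp only: mult_ac)
  then have "w = v * P" using v by simp
  moreover have "v dvd 1" using v by (metis dvd_def mult.commute)
  ultimately show ?thesis using P(3)[of 0] by (intro that[of v "- (P $ 0)"]) auto
qed

lemma smooth_curve_graphI:
  fixes \<phi> :: "'k::field fps"
  assumes "\<phi> $ 0 = 0"
  shows "smooth_curve (graph \<phi>)"
proof -
  have "ord2 (graph \<phi>) = 1"
    by (rule ord2_eqI[of 1 _ 0 1]) (use assms in \<open>auto simp: graph_def\<close>)
  moreover have "graph \<phi> $ 1 \<noteq> 0" by (simp add: graph_def)
  then have "graph \<phi> \<noteq> 0" by auto
  ultimately show ?thesis by (simp add: smooth_curve_iff_ord2)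
qed

lemma intersection_mult_graph_ge_iff:
  fixes \<phi> :: "'k::field fps"
  assumes "\<phi> $ 0 = 0" "u dvd 1"
  shows "enat N \<le> intersection_mult p (u * graph \<phi>) \<longleftrightarrow> fps_X ^ N dvd restriction \<phi> p"
proof (cases "restriction \<phi> p = 0")
  case False
  then have "N \<le> subdegree (restriction \<phi> p) \<longleftrightarrow> (\<forall>i<N. restriction \<phi> p $ i = 0)"
    using subdegree_geI[of "restriction \<phi> p" N] by (auto intro: nth_less_subdegree_zero)
  then show ?thesis
    using False by (simp add: intersection_mult_graph[OF assms] fps_X_power_dvd_iff)
qed (simp add: intersection_mult_graph[OF assms])

text \<open>
  If $p$ has order at least $m$ and $F$ is its homogeneous part of degree $m$, then
  $p(x, b x + \dots) = F(1, b) x^m + \dots$.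
\<close>

lemma restriction_nth_ord:
  fixes \<phi> :: "'k::field fps"
  assumes \<phi>: "\<phi> $ 0 = 0" and p: "\<And>i j. i + j < m \<Longrightarrow> p $ j $ i = 0"
  shows "k < m \<Longrightarrow> restriction \<phi> p $ k = 0"
    and "restriction \<phi> p $ m = (\<Sum>j\<le>m. p $ j $ (m - j) * (\<phi> $ 1) ^ j)"
proof -
  define \<psi> where "\<psi> = fps_shift 1 \<phi>"
  have \<phi>_eq: "\<phi> = fps_X * \<psi>"
    using \<phi> by (auto simp: \<psi>_def fps_eq_iff)
  have term_eq: "p $ j * \<phi> ^ j = fps_X ^ m * (fps_shift (m - j) (p $ j) * \<psi> ^ j)" if "j \<le> m" for j
  proof -
    have "p $ j = fps_X ^ (m - j) * fps_shift (m - j) (p $ j)"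
      by (rule fps_ext) (use p that in \<open>auto simp: fps_X_power_mult_nth\<close>)
    moreover have "\<phi> ^ j = fps_X ^ j * \<psi> ^ j" by (simp add: \<phi>_eq power_mult_distrib)
    ultimately have "p $ j * \<phi> ^ j =
        (fps_X ^ (m - j) * fps_shift (m - j) (p $ j)) * (fps_X ^ j * \<psi> ^ j)" by simp
    also have "\<dots> = (fps_X ^ (m - j) * fps_X ^ j) * (fps_shift (m - j) (p $ j) * \<psi> ^ j)"
      by (simp only: mult_ac)
    finally show ?thesis using that by (simp flip: power_add)
  qed
  have coeff: "(p $ j * \<phi> ^ j) $ k = (if k = m then p $ j $ (m - j) * (\<phi> $ 1) ^ j else 0)"
    if "j \<le> m" "k \<le> m" for j k
    using that by (simp add: term_eq fps_X_power_mult_nth) (simp add: \<psi>_def fps_nth_power_0)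
  show "k < m \<Longrightarrow> restriction \<phi> p $ k = 0"
    by (simp add: restriction_nth[OF \<phi>, of k m] coeff)
  show "restriction \<phi> p $ m = (\<Sum>j\<le>m. p $ j $ (m - j) * (\<phi> $ 1) ^ j)"
    by (simp add: restriction_nth[OF \<phi>, of m m] coeff)
qed

lemma intersection_mult_graph_ge_ord2:
  fixes \<phi> :: "'k::field fps"
  assumes "\<phi> $ 0 = 0" "u dvd 1"
  shows "enat (ord2 p) \<le> intersection_mult p (u * graph \<phi>)"
  unfolding intersection_mult_graph_ge_iff[OF assms] fps_X_power_dvd_iff
  using restriction_nth_ord(1)[OF assms(1), of "ord2 p" p] nth_eq_0_of_less_ord2 by blast

lemma contact_graph_ge_1:
  fixes \<phi> :: "'k::field fps"
  assumes "\<phi> $ 0 = 0"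
  shows "1 \<le> contact f (graph \<phi>)"
  unfolding contact_smooth[OF smooth_curve_graphI[OF assms]]
proof (rule INF_greatest)
  fix p assume "p \<in> branches f"
  then have "ord2 p > 0" by (auto simp: branches_def branch_def algebroid_curve_iff_ord2)
  then show "1 \<le> branch_contact p (graph \<phi>)"
    using branch_contact_ge_iff[OF smooth_curve_graphI[OF assms], of p 1]
      intersection_mult_graph_ge_ord2[OF assms, of 1 p] by (simp flip: one_ereal_def)
qed

text \<open>
  Intersection multiplicities are products of multiplicities when there is no common tangent. The
  two alternatives are the cases in which this is needed: either $w$ is tangent to $x = 0$, which is
  not tangent to $p$; or $w$ is any smooth curve not tangent to the $x$-axis, and $p$ is horizontal.
  Exchanging the variables makes $w$ a graph.
\<close>

lemma intersection_mult_transversal: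
  fixes p w :: "'k::field fps2"
  assumes w: "smooth_curve w" "w $ 0 $ 1 \<noteq> 0" and p: "p $ ord2 p $ 0 \<noteq> 0"
    and "w $ 1 $ 0 = 0 \<or> horizontal (ord2 p) p"
  shows "intersection_mult p w = enat (ord2 p)"
proof -
  define m where "m = ord2 p"
  interpret swap: K_automorphism swap swap by (rule K_automorphism_swap)
  have "smooth_curve (swap w)" "swap w $ 1 $ 0 \<noteq> 0" using w by (simp_all add: swap.smooth_curve_iff)
  then obtain u \<phi> where u: "u dvd 1" and \<phi>: "\<phi> $ 0 = 0" and sw: "swap w = u * graph \<phi>"
    by (rule smooth_curve_graph)
  have low: "swap p $ j $ i = 0" if "i + j < m" for i j
    using that by (simp add: m_def nth_eq_0_of_less_ord2)
  have "swap p $ j $ (m - j) * (\<phi> $ 1) ^ j = 0" if "0 < j" "j \<le> m" for j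
  proof (cases "w $ 1 $ 0 = 0")
    case True
    have "w $ 1 $ 0 = swap w $ 0 $ 1" by simp
    also have "\<dots> = - (u $ 0 $ 0 * \<phi> $ 1)"
      using \<phi> by (simp add: sw graph_def fps_mult_nth atLeast0_atMost_Suc right_diff_distrib)
    finally have "\<phi> $ 1 = 0" using True u by (auto simp: is_unit_fps2_iff)
    then show ?thesis using that by simp
  next
    case False
    then have "horizontal m p" using assms(4) by (simp add: m_def)
    then show ?thesis using that by (auto simp: horizontal_def)
  qed
  then have "(\<Sum>j\<le>m. swap p $ j $ (m - j) * (\<phi> $ 1) ^ j) = (\<Sum>j\<le>m. if j = 0 then swap p $ 0 $ m else 0)"
    by (intro sum.cong) auto
  then have "restriction \<phi> (swap p) $ m = p $ m $ 0"
    using restriction_nth_ord(2)[OF \<phi> low] by simp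
  then have nz: "restriction \<phi> (swap p) $ m \<noteq> 0" using p by (simp add: m_def)
  then have "subdegree (restriction \<phi> (swap p)) = m"
    by (rule subdegreeI) (rule restriction_nth_ord(1)[OF \<phi> low])
  then have "intersection_mult (swap p) (swap w) = enat m"
    unfolding sw intersection_mult_graph[OF \<phi> u] using nz by auto
  then show ?thesis by (simp add: swap.intersection_mult m_def)
qed

subsection \<open>Noether's formula\<close>

lemma blowup_graph: "blowup (graph (fps_X * \<psi>)) = varX * graph (\<psi> :: 'k::field fps)"
proof (rule fps2_eqI)
  fix i j
  show "blowup (graph (fps_X * \<psi>)) $ j $ i = (varX * graph \<psi>) $ j $ i"
    unfolding blowup_nth_nth varX_mult_nth
    by (cases "j = 0"; cases "j = 1") (auto simp: graph_def)
qed

lemma transform_graph: "transform 1 (graph (fps_X * \<psi>)) = graph (\<psi> :: 'k::field fps)"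
  by (rule transform_eqI) (simp add: blowup_graph)

lemma horizontal_graph:
  "(\<psi> :: 'k::field fps) $ 0 = 0 \<Longrightarrow> horizontal 1 (graph (fps_X * \<psi>))"
  by (auto simp: horizontal_def graph_def)

lemma horizontal_smooth_curve: "horizontal 1 (w :: 'k::field fps2) \<longleftrightarrow> smooth_curve w \<and> w $ 0 $ 1 = 0"
proof
  assume "horizontal 1 w"
  then show "smooth_curve w \<and> w $ 0 $ 1 = 0"
    using horizontal_ord2 horizontal_nonzero by (auto simp: smooth_curve_iff_ord2 horizontal_def)
next
  assume *: "smooth_curve w \<and> w $ 0 $ 1 = 0"
  then have "w \<noteq> 0" "ord2 w = 1" by (auto simp: smooth_curve_iff_ord2)
  then obtain i j where ij: "i + j = 1" "w $ j $ i \<noteq> 0" using ord2_witness[of w] by metis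
  then have "j = 1 \<and> i = 0 \<or> j = 0 \<and> i = 1" by auto
  then have "w $ 1 $ 0 \<noteq> 0" using ij * by auto
  moreover have "w $ j $ i = 0" if "i + j \<le> 1" "j \<noteq> 1" for i j
  proof -
    have "j = 0" "i = 0 \<or> i = 1" using that by auto
    then show ?thesis using * nth_eq_0_of_less_ord2[of 0 0 w] \<open>ord2 w = 1\<close> by auto
  qed
  ultimately show "horizontal 1 w" by (simp add: horizontal_def)
qed

lemma blowup_unit: "u dvd 1 \<Longrightarrow> blowup u dvd (1 :: 'k::field fps2)"
  by (simp add: is_unit_fps2_iff blowup_nth)

lemma horizontal_smooth_graph:
  fixes w :: "'k::field fps2"
  assumes "horizontal 1 w"
  obtains u \<psi> where "u dvd 1" "\<psi> $ 0 = 0" "w = u * graph (fps_X * \<psi>)"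
    "transform 1 w = blowup u * graph \<psi>"
proof -
  have w: "smooth_curve w" "w $ 0 $ 1 = 0" "w $ 1 $ 0 \<noteq> 0"
    using assms horizontal_smooth_curve[of w] by (blast, blast, simp add: horizontal_def)
  then obtain u \<phi> where u: "u dvd 1" and \<phi>: "\<phi> $ 0 = 0" and wu: "w = u * graph \<phi>"
    by (metis smooth_curve_graph)
  have "w $ 0 $ 1 = - (u $ 0 $ 0 * \<phi> $ 1)"
    using \<phi> by (simp add: wu graph_def fps_mult_nth atLeast0_atMost_Suc right_diff_distrib)
  then have \<phi>1: "\<phi> $ 1 = 0" using w(2) u by (auto simp: is_unit_fps2_iff)
  define \<psi> where "\<psi> = fps_shift 1 \<phi>"
  have \<phi>_eq: "\<phi> = fps_X * \<psi>" using \<phi> by (auto simp: \<psi>_def fps_eq_iff)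
  have "transform 1 w = blowup u * graph \<psi>"
    by (rule transform_eqI) (simp add: wu \<phi>_eq blowup_mult blowup_graph mult.left_commute)
  moreover have "w = u * graph (fps_X * \<psi>)" using wu \<phi>_eq by simp
  ultimately show ?thesis using u \<phi>1 by (intro that[of u \<psi>]) (simp_all add: \<psi>_def)
qed

lemma smooth_curve_transform:
  fixes w :: "'k::field fps2"
  assumes "horizontal 1 w"
  shows "smooth_curve (transform 1 w)"
proof -
  obtain u \<psi> where "u dvd 1" "\<psi> $ 0 = 0" "transform 1 w = blowup u * graph \<psi>"
    using horizontal_smooth_graph[OF assms] by metis
  then show ?thesis by (simp add: smooth_curve_unit blowup_unit smooth_curve_graphI)
qed

lemma restriction_transform:
  fixes p :: "'k::field fps2"
  assumes "\<psi> $ 0 = 0" and p: "\<And>i j. i + j < m \<Longrightarrow> p $ j $ i = 0"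
  shows "restriction (fps_X * \<psi>) p = fps_X ^ m * restriction \<psi> (transform m p)"
proof -
  obtain q where q: "p = q * graph (fps_X * \<psi>) + fps_const (restriction (fps_X * \<psi>) p)"
    using divide_by_graph[of "fps_X * \<psi>" p] by auto
  have "varX ^ m * transform m p = blowup p" by (rule varX_power_mult_transform) (rule p)
  also have "\<dots> = (blowup q * varX) * graph \<psi> + fps_const (restriction (fps_X * \<psi>) p)"
    by (subst q) (simp add: blowup_add blowup_mult blowup_graph blowup_fps_const mult.assoc)
  finally have "restriction \<psi> (varX ^ m * transform m p) = restriction (fps_X * \<psi>) p"
    by (rule restriction_eqI[OF assms(1)])
  then show ?thesis
    by (simp add: restriction_mult[OF assms(1)] varX_power restriction_fps_const[OF assms(1)])
qed

text \<open>
  Inserting $y = x \<psi>(x)$ in $p$ amounts to inserting $y = \<psi>(x)$ in $p(x, x y)$, which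
  is $x^m$ times the transform.
\<close>

theorem Noether_formula:
  fixes p w :: "'k::field fps2"
  assumes "horizontal m p" "horizontal 1 w"
  shows "intersection_mult p w = enat m + intersection_mult (transform m p) (transform 1 w)"
proof -
  obtain u \<psi> where u: "u dvd 1" and \<psi>: "\<psi> $ 0 = 0"
    and w: "w = u * graph (fps_X * \<psi>)" "transform 1 w = blowup u * graph \<psi>"
    using horizontal_smooth_graph[OF assms(2)] by metis
  have r: "restriction (fps_X * \<psi>) p = fps_X ^ m * restriction \<psi> (transform m p)"
    using assms(1) by (intro restriction_transform \<psi>) (auto simp: horizontal_def)
  show ?thesis
    unfolding w(2) unfolding w(1) intersection_mult_graph[OF \<psi> blowup_unit[OF u]]
    using intersection_mult_graph[OF _ u, of "fps_X * \<psi>" p]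
    by (auto simp: r fps_X_power_subdegree)
qed

section \<open>Contact exponent and quadratic transform\<close>

text \<open>
  Both sides are the value at $(1, b)$ of the homogeneous part of $p$ of degree $n$.
\<close>

lemma shear_nth_x_power: "shear b p $ 0 $ n = (\<Sum>j\<le>n. p $ j $ (n - j) * b ^ j)"
proof -
  have "shear b p $ 0 $ n = coeff (graded (shear b p) $ n) 0" by (simp add: coeff_graded)
  also have "\<dots> = poly (graded p $ n) b"
    by (simp add: graded_shear_nth poly_pcompose flip: poly_0_coeff_0)
  also have "\<dots> = (\<Sum>j\<le>n. p $ j $ (n - j) * b ^ j)"
    using degree_graded[of p n]
    by (subst poly_as_sum_of_monoms'[of "graded p $ n" n, symmetric])
      (auto simp: poly_sum poly_monom coeff_graded intro!: sum.cong)
  finally show ?thesis .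
qed

lemma shear_nth_y_power: "shear b p $ n $ 0 = p $ n $ 0"
proof -
  have "shear b p $ n $ 0 = coeff (graded (shear b p) $ n) n" by (simp add: coeff_graded)
  also have "\<dots> = coeff (graded p $ n) n"
  proof (cases "degree (graded p $ n) = n")
    case True
    then show ?thesis
      using lead_coeff_comp[of "[:b, 1:]" "graded p $ n"]
      by (simp add: graded_shear_nth degree_pcompose)
  next
    case False
    then have "degree (graded p $ n) < n" using degree_graded[of p n] by simp
    then show ?thesis by (simp add: graded_shear_nth coeff_eq_0 degree_pcompose)
  qed
  finally show ?thesis by (simp add: coeff_graded)
qed

text \<open>
  The branch $h$ meets the two transversal curves $x = 0$ and $y = \<psi>(x)$ with multiplicity at
  least $m$. If its multiplicity were smaller than $m$, both curves would be tangent to it. A shear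
  that makes the tangent of $y = \<psi>(x)$ horizontal turns this into an initial form divisible by
  $x y$.
\<close>

lemma ord2_eq_if_contact_ge:
  fixes h :: "'k::field fps2"
  assumes h: "irreducible h" "y_regular m h" and \<psi>: "\<psi> $ 0 = 0" "fps_X ^ m dvd restriction \<psi> h"
  shows "ord2 h = m"
proof (rule ccontr)
  assume "ord2 h \<noteq> m"
  moreover have "ord2 h \<le> m" using ord2_leI[of h m 0] h(2) by (simp add: y_regular_def)
  ultimately have less: "ord2 h < m" by simp
  define g where "g = shear (\<psi> $ 1) h"
  interpret shear: K_automorphism "shear (\<psi> $ 1)" "shear (- (\<psi> $ 1))"
    by (rule K_automorphism_shear)
  have "irreducible g" using h(1) unfolding g_def by (rule shear.irreducible)
  moreover have "ord2 g = ord2 h" by (simp add: g_def ord2_shear)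
  moreover have "g $ ord2 h $ 0 = 0"
    using less h(2) by (simp add: g_def shear_nth_y_power y_regular_def)
  moreover have "g $ 0 $ ord2 h = 0"
  proof -
    have "g $ 0 $ ord2 h = restriction \<psi> h $ ord2 h"
      unfolding g_def shear_nth_x_power
      by (rule restriction_nth_ord(2)[OF \<psi>(1) nth_eq_0_of_less_ord2, symmetric])
    then show ?thesis using \<psi>(2) less by (simp add: fps_X_power_dvd_iff)
  qed
  ultimately show False using irreducible_initial_form_not_split[of g] by simp
qed

text \<open>
  The order of a factor cannot grow under the transform. As orders add up, it cannot drop for a
  branch if it does not drop for the whole curve.
\<close>

lemma ord2_transform_branch:
  fixes f :: "'k::field fps2"
  assumes f: "horizontal n f" "ord2 (transform n f) = n" and p: "p \<in> branches f"
  shows "ord2 (transform (ord2 p) p) = ord2 p"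
proof -
  obtain k where k: "f = p * k" using p by (auto simp: branches_def dvd_def)
  note hk = horizontal_mult[of n p k, folded k, OF f(1)]
  have "n > 0" using branches_horizontal(3,4)[OF f(1) p] by simp
  then have "transform n f \<noteq> 0" using horizontal_transform_not_unit[OF f(1)] by simp
  then have "ord2 (transform (ord2 p) p) + ord2 (transform (ord2 k) k) = ord2 p + ord2 k"
    using f(2) hk(1,4) ord2_mult[of "transform (ord2 p) p" "transform (ord2 k) k"] by auto
  moreover have "ord2 (transform (ord2 p) p) \<le> ord2 p" "ord2 (transform (ord2 k) k) \<le> ord2 k"
    using hk by (simp_all add: ord2_transform_le)
  ultimately show ?thesis by simp
qed

text \<open>
  Conversely, split off one branch at a time.
\<close>

lemma ord2_transform_eqI:
  fixes f :: "'k::field fps2"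
  assumes "horizontal n f" "\<And>p. p \<in> branches f \<Longrightarrow> ord2 (transform (ord2 p) p) = ord2 p"
  shows "ord2 (transform n f) = n"
  using assms
proof (induction n arbitrary: f rule: less_induct)
  case (less n)
  show ?case
  proof (cases "n = 0")
    case True
    then show ?thesis using ord2_transform_le[OF less.prems(1)] by simp
  next
    case False
    have nf: "f \<noteq> 0" "\<not> f dvd 1"
      using False horizontal_nonzero[OF less.prems(1)] horizontal_ord2[OF less.prems(1)]
        ord2_eq_0_iff[of f] by auto
    obtain p where p: "irreducible p" "p dvd f" using irreducible_factor_exists[OF nf] by blast
    then have pb: "p \<in> branches f" by (simp add: branches_def branch_iff_irreducible)
    obtain k where k: "f = p * k" using p by (auto simp: dvd_def)
    note hk = horizontal_mult[of n p k, folded k, OF less.prems(1)]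
    have "ord2 k < n" using hk(1) branches_horizontal(3)[OF less.prems(1) pb] by simp
    moreover have "ord2 (transform (ord2 q) q) = ord2 q" if "q \<in> branches k" for q
      using that less.prems(2)[of q] by (auto simp: branches_def k)
    ultimately have "ord2 (transform (ord2 k) k) = ord2 k" using less.IH hk(3) by blast
    moreover have "transform n f \<noteq> 0"
      using horizontal_transform_not_unit[OF less.prems(1)] False by simp
    ultimately show ?thesis
      using hk(1,4) less.prems(2)[OF pb] ord2_mult[of "transform (ord2 p) p" "transform (ord2 k) k"]
      by auto
  qed
qed

lemma contact_transform:
  fixes f :: "'k::field fps2"
  assumes "horizontal n f" "smooth_curve w"
  shows "contact (transform n f) w = (INF p\<in>branches f. branch_contact (transform (ord2 p) p) w)"
  unfolding contact_smooth[OF assms(2)]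
proof (rule antisym)
  show "(INF h\<in>branches (transform n f). branch_contact h w) \<le>
      (INF p\<in>branches f. branch_contact (transform (ord2 p) p) w)"
    using transform_branch[OF assms(1)] by (intro INF_mono) auto
  show "(INF p\<in>branches f. branch_contact (transform (ord2 p) p) w) \<le>
      (INF h\<in>branches (transform n f). branch_contact h w)"
  proof (rule INF_mono)
    fix h assume "h \<in> branches (transform n f)"
    then obtain p u where "p \<in> branches f" "u dvd 1" "transform (ord2 p) p = u * h"
      using branch_of_transform[OF assms(1)] by metis
    then show "\<exists>p\<in>branches f. branch_contact (transform (ord2 p) p) w \<le> branch_contact h w"
      by (intro bexI[of _ p]) (simp_all add: branch_contact_unit)
  qed
qed

lemma branches_nonempty:
  fixes f :: "'k::field fps2"
  assumes "horizontal n f" "n > 0"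
  shows "branches f \<noteq> {}"
proof -
  have "f \<noteq> 0" "\<not> f dvd 1"
    using assms horizontal_nonzero[OF assms(1)] horizontal_ord2[OF assms(1)] ord2_eq_0_iff[of f]
    by auto
  then show ?thesis
    using irreducible_factor_exists[of f] by (auto simp: branches_def branch_iff_irreducible)
qed

text \<open>
  Noether's formula for a branch, divided by the multiplicity, which is common to the branch and its
  transform.
\<close>

lemma contact_eq_contact_transform:
  fixes f :: "'k::field fps2"
  assumes f: "horizontal n f" "n > 0" "ord2 (transform n f) = n" and w: "horizontal 1 w"
  shows "contact f w = contact (transform n f) (transform 1 w) + 1"
proof -
  have sw: "smooth_curve w" "smooth_curve (transform 1 w)"
    using w smooth_curve_transform[OF w] unfolding horizontal_smooth_curve by blast+
  have "branch_contact p w = branch_contact (transform (ord2 p) p) (transform 1 w) + 1"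
    if p: "p \<in> branches f" for p
  proof -
    have hp: "horizontal (ord2 p) p" "ord2 p > 0" using branches_horizontal[OF f(1) p] by auto
    have "intersection_mult p w =
        enat (ord2 p) + intersection_mult (transform (ord2 p) p) (transform 1 w)"
      by (rule Noether_formula[OF hp(1) w])
    then show ?thesis
      using hp(2) by (cases "intersection_mult (transform (ord2 p) p) (transform 1 w)")
        (simp_all add: branch_contact_smooth[OF sw(1)] branch_contact_smooth[OF sw(2)[simplified]]
          ord2_transform_branch[OF f(1,3) p] add_divide_distrib add.commute one_ereal_def)
  qed
  then have "contact f w =
      (INF p\<in>branches f. branch_contact (transform (ord2 p) p) (transform 1 w) + 1)"
    by (simp add: contact_smooth[OF sw(1)])
  also have "\<dots> = contact (transform n f) (transform 1 w) + 1"
    unfolding contact_transform[OF f(1) sw(2)]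
    by (rule INF_ereal_add_left)
      (use branches_nonempty[OF f(1,2)] branch_contact_nonneg in auto)
  finally show ?thesis .
qed

lemma contact_transversal_le_1:
  fixes f :: "'k::field fps2"
  assumes f: "horizontal n f" "n > 0" and w: "smooth_curve w" "w $ 0 $ 1 \<noteq> 0"
  shows "contact f w \<le> 1"
proof -
  obtain p where p: "p \<in> branches f" using branches_nonempty[OF f] by auto
  have hp: "horizontal (ord2 p) p" "ord2 p > 0" using branches_horizontal[OF f(1) p] by auto
  have "intersection_mult p w = enat (ord2 p)"
    using hp(1) by (intro intersection_mult_transversal[OF w]) (auto simp: horizontal_def)
  then have "branch_contact p w = 1" by (rule branch_contact_eq_1[OF w(1) hp(2)])
  then show ?thesis using p by (auto simp: contact_smooth[OF w(1)] intro: INF_lower2)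
qed

lemma contact_exponent_ge:
  fixes w :: "'k::field fps2"
  shows "smooth_curve w \<Longrightarrow> contact f w \<le> contact_exponent f"
  unfolding contact_exponent_def
  by (rule SUP_upper) (simp add: branch_iff_irreducible smooth_curve_irreducible)

lemma horizontal_x_axis: "horizontal 1 (graph 0 :: 'k::field fps2)"
  using horizontal_graph[of 0] by simp

lemma transform_x_axis: "transform 1 (graph 0) = (graph 0 :: 'k::field fps2)"
  using transform_graph[of 0] by simp

lemma contact_exponent_ge_2:
  fixes f :: "'k::field fps2"
  assumes "horizontal n f" "n > 0" "ord2 (transform n f) = n"
  shows "2 \<le> contact_exponent f"
proof -
  have "(1 :: ereal) \<le> contact (transform n f) (graph 0)" by (rule contact_graph_ge_1) simp
  then have "1 + 1 \<le> contact (transform n f) (graph 0) + (1::ereal)" by (rule add_right_mono)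
  also have "\<dots> = contact f (graph 0)"
    unfolding contact_eq_contact_transform[OF assms horizontal_x_axis] transform_x_axis ..
  also have "\<dots> \<le> contact_exponent f" by (rule contact_exponent_ge) (simp add: smooth_curve_graphI)
  finally show ?thesis by (simp add: one_ereal_def)
qed

text \<open>
  If $w$ has contact less than $2$ with $f$, then it has contact less than $2$ with some branch, of
  multiplicity $m \<le> n$ say. That contact is a fraction with denominator $m$, so it is at most
  $2 - 1/m \<le> 2 - 1/n$. Hence contacts less than $2$ stay away from $2$.
\<close>

lemma contact_ge_2_attained:
  fixes f :: "'k::field fps2"
  assumes f: "horizontal n f" "n > 0" and ge: "2 \<le> contact_exponent f"
  shows "\<exists>w. smooth_curve w \<and> 2 \<le> contact f w"
proof (rule ccontr)
  assume "\<not> ?thesis"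
  then have less: "contact f w < 2" if "smooth_curve w" for w using that by force
  have "contact f w \<le> ereal (2 - 1 / real n)" if w: "smooth_curve w" for w
  proof -
    obtain p where p: "p \<in> branches f" and "branch_contact p w < 2"
      using less[OF w] by (auto simp: contact_smooth[OF w] INF_less_iff)
    define m where "m = ord2 p"
    have m: "0 < m" "m \<le> n" using branches_horizontal[OF f(1) p] by (auto simp: m_def)
    have "\<not> ereal (real 2) \<le> branch_contact p w"
      using \<open>branch_contact p w < 2\<close> by (simp add: not_le)
    then have "\<not> enat (2 * m) \<le> intersection_mult p w"
      using branch_contact_ge_iff[OF w, of p 2] m by (simp add: m_def)
    then obtain e where e: "intersection_mult p w = enat e" "e < 2 * m"
      by (cases "intersection_mult p w") auto
    then have "real e \<le> 2 * real m - 1" by linarith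
    then have "real e / real m \<le> 2 - 1 / real m" using m by (simp add: field_simps)
    also have "\<dots> \<le> 2 - 1 / real n" using m by (simp add: frac_le)
    finally have "branch_contact p w \<le> ereal (2 - 1 / real n)"
      using m e by (simp add: branch_contact_smooth[OF w] m_def)
    then show ?thesis using p by (auto simp: contact_smooth[OF w] intro: INF_lower2)
  qed
  then have "contact_exponent f \<le> ereal (2 - 1 / real n)"
    unfolding contact_exponent_def by (intro SUP_least) simp
  with ge have "ereal 2 \<le> ereal (2 - 1 / real n)" by (metis order_trans numeral_eq_ereal)
  then show False using f(2) by simp
qed

text \<open>
  A smooth curve that has contact at least $2$ with $f$ is tangent to $f$. By Noether's formula its
  transform meets the transform of each branch $p$ with multiplicity at least $m(p)$, and so does the
  exceptional curve $x = 0$. Therefore no branch loses multiplicity.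
\<close>

lemma ord2_transform_if_contact_exponent_ge_2:
  fixes f :: "'k::field fps2"
  assumes f: "horizontal n f" "n > 0" and ge: "2 \<le> contact_exponent f"
  shows "ord2 (transform n f) = n"
proof -
  obtain w where w: "smooth_curve w" "2 \<le> contact f w"
    using contact_ge_2_attained[OF assms] by blast
  have "w $ 0 $ 1 = 0"
  proof (rule ccontr)
    assume "w $ 0 $ 1 \<noteq> 0"
    then have "contact f w \<le> 1" by (rule contact_transversal_le_1[OF f w(1)])
    with w(2) have "(2::ereal) \<le> 1" by (rule order_trans)
    then have "ereal 2 \<le> ereal 1" by (metis numeral_eq_ereal one_ereal_def)
    then show False by simp
  qed
  then have hw: "horizontal 1 w" using w(1) unfolding horizontal_smooth_curve by blast
  then obtain u \<psi> where u: "u dvd 1" and \<psi>: "\<psi> $ 0 = 0" and tw: "transform 1 w = blowup u * graph \<psi>"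
    using horizontal_smooth_graph by metis
  have "ord2 (transform (ord2 p) p) = ord2 p" if p: "p \<in> branches f" for p
  proof -
    note hp = branches_horizontal[OF f(1) p]
    have "2 \<le> branch_contact p w"
      using w p by (auto simp: contact_smooth[OF w(1)] le_INF_iff)
    then have "enat (2 * ord2 p) \<le> intersection_mult p w"
      using branch_contact_ge_iff[OF w(1) hp(3), of 2] by simp
    also have "\<dots> = enat (ord2 p) + intersection_mult (transform (ord2 p) p) (transform 1 w)"
      by (rule Noether_formula[OF hp(2) hw])
    finally have "enat (ord2 p) \<le> intersection_mult (transform (ord2 p) p) (transform 1 w)"
      by (cases "intersection_mult (transform (ord2 p) p) (transform 1 w)") auto
    then have "fps_X ^ ord2 p dvd restriction \<psi> (transform (ord2 p) p)"
      unfolding tw intersection_mult_graph_ge_iff[OF \<psi> blowup_unit[OF u]] .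
    then show ?thesis
      by (rule ord2_eq_if_contact_ge[OF irreducible_transform[OF hp(1,2)]
            horizontal_transform_y_regular[OF hp(2)] \<psi>])
  qed
  then show ?thesis by (rule ord2_transform_eqI[OF f(1)])
qed

text \<open>
  Transformation maps the smooth curves tangent to $f$ onto the smooth curves not tangent to the
  exceptional curve $x = 0$, up to units, and lowers the contact by $1$. The remaining smooth curves
  have contact at most $1$ with $f$ and with its transform respectively, because $x = 0$ is
  tangent neither to $f$ nor, when the multiplicity is preserved, to the transform. So they do not
  contribute to the suprema.
\<close>

theorem contact_exponent_transform:
  fixes f :: "'k::field fps2"
  assumes f: "horizontal n f" "n > 0" and ord: "ord2 (transform n f) = n"
  shows "contact_exponent f = contact_exponent (transform n f) + 1"
proof (rule antisym)
  let ?F = "transform n f"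
  have zero: "contact f (graph 0) = contact ?F (graph 0) + 1"
    unfolding contact_eq_contact_transform[OF f ord horizontal_x_axis] transform_x_axis ..
  have ge1: "1 \<le> contact ?F (graph 0)" by (rule contact_graph_ge_1) simp
  have sm0: "smooth_curve (graph 0 :: 'k fps2)" by (simp add: smooth_curve_graphI)
  show "contact_exponent f \<le> contact_exponent ?F + 1"
  proof (subst contact_exponent_def, rule SUP_least, clarify)
    fix w :: "'k fps2" assume w: "smooth_curve w"
    show "contact f w \<le> contact_exponent ?F + 1"
    proof (cases "w $ 0 $ 1 = 0")
      case True
      with w have hw: "horizontal 1 w" unfolding horizontal_smooth_curve by blast
      have "contact f w = contact ?F (transform 1 w) + 1"
        by (rule contact_eq_contact_transform[OF f ord hw])
      also have "\<dots> \<le> contact_exponent ?F + 1"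
        by (intro add_right_mono contact_exponent_ge smooth_curve_transform hw)
      finally show ?thesis .
    next
      case False
      have "contact f w \<le> 1" by (rule contact_transversal_le_1[OF f w False])
      also have "\<dots> \<le> contact ?F (graph 0)" by (rule ge1)
      also have "\<dots> \<le> contact_exponent ?F" using sm0 by (rule contact_exponent_ge)
      also have "\<dots> \<le> contact_exponent ?F + 1" by (simp add: ereal_le_add_self)
      finally show ?thesis .
    qed
  qed
  have each: "contact ?F w + 1 \<le> contact_exponent f" if w: "smooth_curve w" for w
  proof (cases "w $ 1 $ 0 = 0")
    case False
    then obtain u \<psi> where u: "u dvd 1" and \<psi>: "\<psi> $ 0 = 0" and wu: "w = u * graph \<psi>"
      using smooth_curve_graph[OF w] by metis
    have "contact ?F w = contact ?F (graph \<psi>)"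
      unfolding wu by (rule contact_unit_right[OF u smooth_curve_graphI[OF \<psi>]])
    then have "contact ?F w + 1 = contact f (graph (fps_X * \<psi>))"
      using contact_eq_contact_transform[OF f ord horizontal_graph[OF \<psi>]]
      by (simp add: transform_graph[simplified])
    also have "\<dots> \<le> contact_exponent f"
      by (rule contact_exponent_ge) (simp add: smooth_curve_graphI)
    finally show ?thesis .
  next
    case True
    have "w $ 0 $ 1 \<noteq> 0"
    proof
      assume "w $ 0 $ 1 = 0"
      with w have "horizontal 1 w" unfolding horizontal_smooth_curve by blast
      with True show False by (simp add: horizontal_def)
    qed
    obtain p where p: "p \<in> branches f" using branches_nonempty[OF f] by auto
    note hp = branches_horizontal[OF f(1) p]
    define h where "h = transform (ord2 p) p"
    have ordh: "ord2 h = ord2 p" using ord2_transform_branch[OF f(1) ord p] by (simp add: h_def)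
    have "h $ ord2 h $ 0 \<noteq> 0"
      using horizontal_transform_y_regular[OF hp(2)] ordh by (simp add: h_def y_regular_def)
    then have "intersection_mult h w = enat (ord2 h)"
      using True by (intro intersection_mult_transversal[OF w \<open>w $ 0 $ 1 \<noteq> 0\<close>]) auto
    then have "branch_contact h w = 1"
      using hp(3) ordh by (intro branch_contact_eq_1[OF w]) auto
    then have "contact ?F w \<le> 1"
      using p by (auto simp: contact_transform[OF f(1) w] h_def intro: INF_lower2)
    also note ge1
    finally have "contact ?F w + 1 \<le> contact ?F (graph 0) + 1" by (rule add_right_mono)
    also have "\<dots> \<le> contact_exponent f" using contact_exponent_ge[OF sm0] by (simp flip: zero)
    finally show ?thesis .
  qed
  have "contact_exponent ?F + 1 =
      (SUP w\<in>{w. branch w \<and> smooth_curve w}. contact ?F w + 1)"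
    unfolding contact_exponent_def
    by (rule SUP_ereal_add_left[symmetric])
      (use sm0 in \<open>auto simp: branch_iff_irreducible intro: smooth_curve_irreducible\<close>)
  also have "\<dots> \<le> contact_exponent f" using each by (intro SUP_least) simp
  finally show "contact_exponent ?F + 1 \<le> contact_exponent f" .
qed

text \<open>
  Everything follows from two facts: the multiplicity is preserved exactly when the contact exponent
  is at least $2$, and in that case all relevant contacts drop by $1$.
\<close>

theorem horizontal_quadratic_transform:
  fixes f :: "'k::field fps2"
  assumes f: "horizontal n f" "n > 0"
  shows "contact_exponent f < 2 \<Longrightarrow> ord2 (transform n f) < n"
    and "2 \<le> contact_exponent f \<Longrightarrow> ord2 (transform n f) = n"
    and "2 \<le> contact_exponent f \<Longrightarrow> contact_exponent (transform n f) = contact_exponent f - 1"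
    and "2 \<le> contact_exponent f \<Longrightarrow> horizontal 1 w \<Longrightarrow>
      contact f w = contact (transform n f) (transform 1 w) + 1"
    and "2 \<le> contact_exponent f \<Longrightarrow> horizontal 1 w \<Longrightarrow> maximal_contact w f \<Longrightarrow>
      maximal_contact (transform 1 w) (transform n f)"
proof -
  assume "contact_exponent f < 2"
  then have "ord2 (transform n f) \<noteq> n" using contact_exponent_ge_2[OF f] by (auto simp: not_le)
  then show "ord2 (transform n f) < n" using ord2_transform_le[OF f(1)] by simp
next
  assume ge: "2 \<le> contact_exponent f"
  show ord: "ord2 (transform n f) = n" by (rule ord2_transform_if_contact_exponent_ge_2[OF f ge])
  have ce: "contact_exponent f = contact_exponent (transform n f) + 1"
    by (rule contact_exponent_transform[OF f ord])
  then show "contact_exponent (transform n f) = contact_exponent f - 1"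
    by (cases "contact_exponent (transform n f)") (simp_all add: one_ereal_def)
  assume w: "horizontal 1 w"
  show eq: "contact f w = contact (transform n f) (transform 1 w) + 1"
    by (rule contact_eq_contact_transform[OF f ord w])
  assume "maximal_contact w f"
  then have "contact f w = contact_exponent f" by (simp add: maximal_contact_def)
  then have "contact (transform n f) (transform 1 w) = contact_exponent (transform n f)"
    unfolding eq ce
    by (cases "contact (transform n f) (transform 1 w)"; cases "contact_exponent (transform n f)")
      (simp_all add: one_ereal_def)
  then show "maximal_contact (transform 1 w) (transform n f)"
    using smooth_curve_transform[OF w]
    by (simp add: maximal_contact_def branch_iff_irreducible smooth_curve_irreducible)
qed

section \<open>Reduction to a horizontal tangent\<close>

lemma horizontalI:
  fixes f :: "'k::field fps2"
  assumes "graded f $ ord2 f = monom c (ord2 f)" "c \<noteq> 0"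
  shows "horizontal (ord2 f) f"
proof -
  have *: "f $ j $ (ord2 f - j) = (if j = ord2 f then c else 0)" if "j \<le> ord2 f" for j
    using that arg_cong[OF assms(1), of "\<lambda>q. coeff q j"] by (simp add: coeff_graded)
  have "f $ j $ i = 0" if "i + j \<le> ord2 f" "j \<noteq> ord2 f" for i j
  proof (cases "i + j = ord2 f")
    case True
    then have "i = ord2 f - j" by simp
    then show ?thesis using *[of j] that by simp
  next
    case False
    then show ?thesis using that by (simp add: nth_eq_0_of_less_ord2)
  qed
  then show ?thesis using *[of "ord2 f"] assms(2) by (simp add: horizontal_def)
qed

lemma graded_initial_form: "graded (initial_form f) $ d = (if d = ord2 f then graded f $ d else 0)"
  by (rule poly_eqI) (auto simp: coeff_graded initial_form_def coeff2_def)

lemma graded_varX: "graded (varX :: 'k::field fps2) = fps_X"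
  by (intro fps_ext poly_eqI)
    (auto simp: coeff_graded varX_def fps_X_def fps_const_def coeff_pCons coeff_1 split: nat.split)

lemma graded_varY: "graded (varY :: 'k::field fps2) = fps_X * fps_const [:0, 1:]"
  by (intro fps_ext poly_eqI)
    (auto simp: coeff_graded varY_def coeff_pCons split: nat.split)

lemma graded_power_linear_form:
  "graded (const2 c * (varY - const2 (a :: 'k::field) * varX) ^ n) =
    fps_X ^ n * fps_const (smult c ([:- a, 1:] ^ n))"
proof -
  have "graded (varY - const2 a * varX) = graded varY - graded (const2 a) * graded varX"
    by (metis add_diff_cancel_right' diff_add_cancel graded_add graded_mult)
  also have "\<dots> = fps_X * fps_const [:- a, 1:]"
    by (simp add: graded_varX graded_varY graded_const2 mult.commute[of "fps_const [:a:]"]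
        flip: right_diff_distrib fps_const_sub)
  finally have "graded (const2 c * (varY - const2 a * varX) ^ n) =
      fps_const [:c:] * (fps_X ^ n * fps_const ([:- a, 1:] ^ n))"
    by (simp add: graded_mult graded_power graded_const2 power_mult_distrib fps_const_power)
  also have "\<dots> = fps_X ^ n * (fps_const [:c:] * fps_const ([:- a, 1:] ^ n))"
    by (simp only: mult_ac)
  finally show ?thesis by simp
qed

lemma graded_power_varX:
  "graded (const2 c * (varX :: 'k::field fps2) ^ n) = fps_X ^ n * fps_const [:c:]"
  by (simp add: graded_mult graded_power graded_const2 graded_varX mult.commute)

lemma initial_form_eq_iff:
  assumes "graded g = fps_X ^ ord2 f * fps_const q"
  shows "initial_form f = g \<longleftrightarrow> graded f $ ord2 f = (q :: 'k::field poly)"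
proof -
  have "initial_form f = g \<longleftrightarrow> (\<forall>d. (if d = ord2 f then graded f $ d else 0) = (if d = ord2 f then q else 0))"
    by (auto simp: graded_eq_iff[symmetric] fps_eq_iff graded_initial_form assms)
  then show ?thesis by metis
qed

lemma pcompose_power: "(p ^ n) \<circ>\<^sub>p q = (p \<circ>\<^sub>p q) ^ n" for p q :: "'k::field poly"
  by (induction n) (simp_all add: pcompose_mult pcompose_1)

lemma horizontal_shear:
  fixes f :: "'k::field fps2"
  assumes "graded f $ ord2 f = smult c ([:- a, 1:] ^ ord2 f)" "c \<noteq> 0"
  shows "horizontal (ord2 f) (shear a f)"
proof -
  have "graded (shear a f) $ ord2 (shear a f) = monom c (ord2 f)"
    by (simp add: graded_shear_nth ord2_shear assms(1) pcompose_smult pcompose_power pcompose_pCons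
        monom_altdef)
  then show ?thesis using horizontalI[of "shear a f" c] assms(2) by (simp add: ord2_shear)
qed

lemma horizontal_swap:
  fixes f :: "'k::field fps2"
  assumes "graded f $ ord2 f = [:c:]" "c \<noteq> 0"
  shows "horizontal (ord2 f) (swap f)"
proof -
  have *: "f $ j $ (ord2 f - j) = (if j = 0 then c else 0)" if "j \<le> ord2 f" for j
    using that arg_cong[OF assms(1), of "\<lambda>q. coeff q j"]
    by (auto simp: coeff_graded coeff_pCons split: nat.splits)
  have "graded (swap f) $ ord2 f = monom c (ord2 f)"
  proof (rule poly_eqI)
    fix j
    show "coeff (graded (swap f) $ ord2 f) j = coeff (monom c (ord2 f)) j"
      using *[of "ord2 f - j"] by (auto simp: coeff_graded)
  qed
  then show ?thesis using horizontalI[of "swap f" c] assms(2) by (simp add: ord2_swap)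
qed

subsection \<open>The substitutions\<close>

lemma nth_power_const2_plus_varY:
  "((const2 a + varY) ^ j) $ l $ k = (if k = 0 then coeff ([:a, 1:] ^ j) l else (0 :: 'k::field))"
proof (induction j arbitrary: l k)
  case 0
  then show ?case by (auto simp: fps_one_def coeff_1)
next
  case (Suc j)
  have "((const2 a + varY) ^ Suc j) $ l $ k =
      a * ((const2 a + varY) ^ j) $ l $ k + (if l = 0 then 0 else ((const2 a + varY) ^ j) $ (l - 1) $ k)"
    by (simp add: distrib_right const2_def varY_def)
  also have "\<dots> = (if k = 0 then coeff ([:a, 1:] * [:a, 1:] ^ j) l else 0)"
    unfolding Suc by (auto simp: coeff_pCons split: nat.split)
  finally show ?case by simp
qed

text \<open>
  As $x^i (x (a + y))^j = x^{i+j} (a + y)^j$, the coefficient of $x^k$ of the left-hand side is the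
  homogeneous part of $f$ of degree $k$, evaluated at $(1, a + y)$.
\<close>

lemma subst2_shear:
  fixes f :: "'k::field fps2"
  shows "subst2 f varX (const2 a * varX + varX * varY) = blowup (shear a f)"
proof (rule fps2_eqI)
  fix k l
  have mono: "coeff2 (varX ^ i * (const2 a * varX + varX * varY) ^ j) k l =
      (if i + j = k then coeff ([:a, 1:] ^ j) l else 0)" for i j
  proof -
    have "const2 a * varX + varX * varY = varX * (const2 a + varY)"
      by (simp add: algebra_simps)
    then have "varX ^ i * (const2 a * varX + varX * varY) ^ j = varX ^ (i + j) * (const2 a + varY) ^ j"
      by (simp add: power_mult_distrib power_add mult.assoc)
    then show ?thesis
      by (auto simp: coeff2_def varX_power_mult_nth nth_power_const2_plus_varY)
  qed
  have "subst2 f varX (const2 a * varX + varX * varY) $ l $ k =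
      (\<Sum>i\<le>k+l. \<Sum>j\<le>k+l. f $ j $ i * (if i + j = k then coeff ([:a, 1:] ^ j) l else 0))"
    unfolding subst2_def by (simp add: mono) (simp add: coeff2_def)
  also have "\<dots> = (\<Sum>j\<le>k+l. \<Sum>i\<le>k+l. f $ j $ i * (if i + j = k then coeff ([:a, 1:] ^ j) l else 0))"
    by (rule sum.swap)
  also have "\<dots> = (\<Sum>j\<le>k+l. if j \<le> k then f $ j $ (k - j) * coeff ([:a, 1:] ^ j) l else 0)"
  proof (rule sum.cong[OF refl])
    fix j
    have "(\<Sum>i\<le>k+l. f $ j $ i * (if i + j = k then coeff ([:a, 1:] ^ j) l else 0)) =
        (\<Sum>i\<le>k+l. if i = k - j then (if j \<le> k then f $ j $ (k - j) * coeff ([:a, 1:] ^ j) l else 0) else 0)"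
      by (intro sum.cong) auto
    then show "(\<Sum>i\<le>k+l. f $ j $ i * (if i + j = k then coeff ([:a, 1:] ^ j) l else 0)) =
        (if j \<le> k then f $ j $ (k - j) * coeff ([:a, 1:] ^ j) l else 0)"
      by (simp add: le_trans[OF diff_le_self])
  qed
  also have "\<dots> = (\<Sum>j\<le>k. f $ j $ (k - j) * coeff ([:a, 1:] ^ j) l)"
    by (rule sum.mono_neutral_cong_right) auto
  also have "\<dots> = coeff (graded f $ k \<circ>\<^sub>p [:a, 1:]) l"
  proof -
    have "graded f $ k = (\<Sum>j\<le>k. monom (coeff (graded f $ k) j) j)"
      using degree_graded by (rule poly_as_sum_of_monoms'[symmetric])
    also have "\<dots> = (\<Sum>j\<le>k. smult (f $ j $ (k - j)) ([:0, 1:] ^ j))"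
      by (intro sum.cong) (auto simp: coeff_graded monom_altdef)
    finally have "graded f $ k \<circ>\<^sub>p [:a, 1:] =
        (\<Sum>j\<le>k. smult (f $ j $ (k - j)) ([:0, 1:] ^ j)) \<circ>\<^sub>p [:a, 1:]" by simp
    then show ?thesis
      by (simp add: pcompose_sum pcompose_smult pcompose_power pcompose_pCons coeff_sum)
  qed
  also have "\<dots> = blowup (shear a f) $ l $ k"
  proof (cases "k < l")
    case True
    then have "degree (graded f $ k \<circ>\<^sub>p [:a, 1:]) < l"
      using degree_graded[of f k] by (simp add: degree_pcompose)
    then show ?thesis using True by (simp add: blowup_nth_nth coeff_eq_0)
  next
    case False
    then show ?thesis by (simp add: blowup_nth_nth shear_def)
  qed
  finally show "subst2 f varX (const2 a * varX + varX * varY) $ l $ k = blowup (shear a f) $ l $ k" .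
qed

lemma subst2_swap:
  fixes f :: "'k::field fps2"
  shows "subst2 f (varX * varY) varY = swap (blowup (swap f))"
proof (rule fps2_eqI)
  fix k l
  have *: "coeff2 ((varX * varY) ^ i * (varY :: 'k fps2) ^ j) k l = coeff2 (varX ^ j * (varX * varY) ^ i) l k"
    for i j
  proof -
    have "swap ((varX * varY) ^ i * (varY :: 'k fps2) ^ j) = varX ^ j * (varX * varY) ^ i"
      by (simp add: swap_mult swap_power swap_varX swap_varY mult.commute)
    then show ?thesis unfolding coeff2_def by (metis swap_nth)
  qed
  have "subst2 f (varX * varY) varY $ l $ k =
      (\<Sum>i\<le>k+l. \<Sum>j\<le>k+l. f $ j $ i * coeff2 (varX ^ j * (varX * varY) ^ i) l k)"
    unfolding subst2_def by (simp add: *) (simp add: coeff2_def)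
  also have "\<dots> = (\<Sum>j\<le>k+l. \<Sum>i\<le>k+l. f $ j $ i * coeff2 (varX ^ j * (varX * varY) ^ i) l k)"
    by (rule sum.swap)
  also have "\<dots> = subst2 (swap f) varX (const2 0 * varX + varX * varY) $ k $ l"
    unfolding subst2_def by (simp add: const2_def add.commute[of l k]) (simp add: coeff2_def)
  also have "\<dots> = swap (blowup (swap f)) $ l $ k"
    unfolding subst2_shear by (simp add: shear_0)
  finally show "subst2 f (varX * varY) varY $ l $ k = swap (blowup (swap f)) $ l $ k" .
qed

text \<open>
  The slope $a$ is determined by $f$ as the root of the initial form at $(1, y)$; so only one series
  qualifies as strict transform.
\<close>

lemma strict_transform_shear:
  fixes f :: "'k::field fps2"
  assumes q: "graded f $ ord2 f = smult c ([:- a, 1:] ^ ord2 f)" and c: "c \<noteq> 0" and n: "ord2 f > 0"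
  shows "strict_transform f = transform (ord2 f) (shear a f)"
  unfolding strict_transform_def
proof (rule the_equality)
  have eq: "varX ^ ord2 f * transform (ord2 f) (shear a f) = blowup (shear a f)"
    by (rule horizontal_transform[OF horizontal_shear[OF q c]])
  show "is_strict_transform f (transform (ord2 f) (shear a f))"
    unfolding is_strict_transform_def curve_mult_def subst2_shear
      initial_form_eq_iff[OF graded_power_linear_form]
    using q c eq by blast
  fix f1 assume f1: "is_strict_transform f f1"
  then consider
      (a) a' c' where "c' \<noteq> 0" "smult c ([:- a, 1:] ^ ord2 f) = smult c' ([:- a', 1:] ^ ord2 f)"
        "varX ^ ord2 f * f1 = blowup (shear a' f)"
    | (b) c' where "c' \<noteq> 0" "smult c ([:- a, 1:] ^ ord2 f) = [:c':]"
    unfolding is_strict_transform_def curve_mult_def subst2_shear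
      initial_form_eq_iff[OF graded_power_linear_form] initial_form_eq_iff[OF graded_power_varX] q
    by blast
  then show "f1 = transform (ord2 f) (shear a f)"
  proof cases
    case a
    have "poly (smult c' ([:- a', 1:] ^ ord2 f)) a = 0"
      unfolding a(2)[symmetric] using n by simp
    then have "a' = a" using a(1) n by (simp add: poly_power)
    then show ?thesis using a(3) transform_eqI by metis
  next
    case b
    have "poly [:c':] a = 0" unfolding b(2)[symmetric] using n by simp
    then show ?thesis using b(1) by simp
  qed
qed

lemma strict_transform_swap:
  fixes f :: "'k::field fps2"
  assumes q: "graded f $ ord2 f = [:c:]" and c: "c \<noteq> 0" and n: "ord2 f > 0"
  shows "strict_transform f = swap (transform (ord2 f) (swap f))"
  unfolding strict_transform_def
proof (rule the_equality)
  have iff: "varY ^ ord2 f * f1 = swap (blowup (swap f)) \<longleftrightarrow>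
      varX ^ ord2 f * swap f1 = blowup (swap f)" for f1
    by (metis swap_mult swap_power swap_swap swap_varX)
  have eq: "varX ^ ord2 f * transform (ord2 f) (swap f) = blowup (swap f)"
    by (rule horizontal_transform[OF horizontal_swap[OF q c]])
  show "is_strict_transform f (swap (transform (ord2 f) (swap f)))"
    unfolding is_strict_transform_def curve_mult_def subst2_swap iff swap_swap
      initial_form_eq_iff[OF graded_power_varX]
    using q c eq by blast
  fix f1 assume f1: "is_strict_transform f f1"
  then consider
      (a) a' c' where "c' \<noteq> 0" "[:c:] = smult c' ([:- a', 1:] ^ ord2 f)"
    | (b) "varX ^ ord2 f * swap f1 = blowup (swap f)"
    unfolding is_strict_transform_def curve_mult_def subst2_swap iff
      initial_form_eq_iff[OF graded_power_linear_form] initial_form_eq_iff[OF graded_power_varX] q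
    by blast
  then show "f1 = swap (transform (ord2 f) (swap f))"
  proof cases
    case a
    have "poly [:c:] a' = 0" unfolding a(2) using n by simp
    then show ?thesis using c by simp
  next
    case b
    then show ?thesis by (metis transform_eqI swap_swap)
  qed
qed

subsection \<open>Tangent cones\<close>

lemma initial_form_at_eq:
  "initial_form_at f a b = (\<Sum>i\<le>ord2 f. f $ (ord2 f - i) $ i * a ^ i * b ^ (ord2 f - i))"
  unfolding initial_form_at_def
  by (intro sum.cong) (auto simp: coeff2_def initial_form_def)

lemma initial_form_at_scale: "initial_form_at f (t * a) (t * b) = t ^ ord2 f * initial_form_at f a b"
proof -
  have "t ^ ord2 f = t ^ i * t ^ (ord2 f - i)" if "i \<le> ord2 f" for i
    using that by (simp flip: power_add)
  then show ?thesis
    unfolding initial_form_at_eq sum_distrib_left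
    by (intro sum.cong) (auto simp: power_mult_distrib mult_ac)
qed

lemma initial_form_at_1: "initial_form_at f 1 b = poly (graded f $ ord2 f) b"
proof -
  have "poly (graded f $ ord2 f) b = (\<Sum>j\<le>ord2 f. f $ j $ (ord2 f - j) * b ^ j)"
    using degree_graded[of f "ord2 f"]
    by (subst poly_as_sum_of_monoms'[of "graded f $ ord2 f" "ord2 f", symmetric])
      (auto simp: poly_sum poly_monom coeff_graded intro!: sum.cong)
  also have "\<dots> = (\<Sum>i\<le>ord2 f. f $ (ord2 f - i) $ i * b ^ (ord2 f - i))"
    by (rule sum.reindex_bij_witness[of _ "\<lambda>i. ord2 f - i" "\<lambda>i. ord2 f - i"]) auto
  finally show ?thesis by (simp add: initial_form_at_eq)
qed

lemma initial_form_at_0_1: "initial_form_at f 0 1 = coeff (graded f $ ord2 f) (ord2 f)"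
proof -
  have "initial_form_at f 0 1 = (\<Sum>i\<le>ord2 f. if i = 0 then f $ ord2 f $ 0 else 0)"
    unfolding initial_form_at_eq by (intro sum.cong) (auto simp: power_0_left)
  then show ?thesis by (simp add: coeff_graded)
qed

lemma proj_point_mem_tangent_cone:
  fixes f :: "'k::field fps2"
  assumes "(a, b) \<noteq> (0, 0)"
  shows "proj_point a b \<in> tangent_cone f \<longleftrightarrow> initial_form_at f a b = 0"
proof
  assume "proj_point a b \<in> tangent_cone f"
  then obtain a' b' where *: "proj_point a b = proj_point a' b'" "initial_form_at f a' b' = 0"
    by (auto simp: tangent_cone_def)
  have "(a, b) \<in> proj_point a b" by (auto simp: proj_point_def intro!: exI[of _ 1])
  then obtain t where "a = t * a'" "b = t * b'" unfolding * by (auto simp: proj_point_def)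
  then show "initial_form_at f a b = 0" using *(2) by (simp add: initial_form_at_scale)
qed (use assms in \<open>auto simp: tangent_cone_def\<close>)

lemma proj_point_eq_1_iff: "proj_point 1 a = proj_point 1 b \<longleftrightarrow> a = (b :: 'k::field)"
proof
  assume "proj_point 1 a = proj_point 1 b"
  moreover have "(1, a) \<in> proj_point 1 a" by (auto simp: proj_point_def intro!: exI[of _ 1])
  ultimately show "a = b" by (auto simp: proj_point_def)
qed simp

lemma proj_point_0_1_neq: "proj_point 0 1 \<noteq> proj_point 1 (a :: 'k::field)"
proof
  assume *: "proj_point 0 1 = proj_point 1 a"
  have "(1, a) \<in> proj_point 1 a" by (auto simp: proj_point_def intro!: exI[of _ 1])
  then show False unfolding *[symmetric] by (auto simp: proj_point_def)
qed

text \<open>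
  Let $q$ be the initial form at $(1, y)$, of degree at most $n$. The vertical direction belongs to
  the tangent cone when the degree is less than $n$, and then $q$ has no roots. Otherwise $q$ has a
  single root, of multiplicity $n$, because $K$ is algebraically closed.
\<close>

lemma unitangent_cases:
  fixes f :: "'k::alg_closed_field fps2"
  assumes "unitangent f" "f \<noteq> 0" "ord2 f > 0"
  obtains (finite_slope) a c where "c \<noteq> 0" "graded f $ ord2 f = smult c ([:- a, 1:] ^ ord2 f)"
    | (vertical) c where "c \<noteq> 0" "graded f $ ord2 f = [:c:]"
proof -
  define q where "q = graded f $ ord2 f"
  have q0: "q \<noteq> 0" using assms(2) by (simp add: q_def ord2_eq_subdegree graded_eq_0_iff)
  have degq: "degree q \<le> ord2 f" by (simp add: q_def degree_graded)
  have unique: "P = Q" if "P \<in> tangent_cone f" "Q \<in> tangent_cone f" for P Q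
    using assms(1) that by (auto simp: unitangent_def)
  have root: "proj_point 1 t \<in> tangent_cone f \<longleftrightarrow> poly q t = 0" for t
    by (simp add: proj_point_mem_tangent_cone initial_form_at_1 q_def)
  have inf: "proj_point 0 1 \<in> tangent_cone f \<longleftrightarrow> coeff q (ord2 f) = 0"
    by (simp add: proj_point_mem_tangent_cone initial_form_at_0_1 q_def)
  show thesis
  proof (cases "coeff q (ord2 f) = 0")
    case True
    then have "poly q t \<noteq> 0" for t using unique[of "proj_point 0 1"] inf root proj_point_0_1_neq by metis
    then have "degree q = 0" using alg_closed_imp_poly_has_root[of q] by auto
    then obtain c where "q = [:c:]" using degree_eq_zeroE by blast
    then show thesis using q0 vertical[of c] by (auto simp: q_def)
  next
    case False
    then have deg: "degree q = ord2 f" using degq le_degree[of q "ord2 f"] by simp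
    then obtain a where a: "poly q a = 0" using alg_closed_imp_poly_has_root[of q] assms(3) by auto
    obtain A where A: "size A = degree q" "q = smult (lead_coeff q) (\<Prod>x\<in>#A. [:-x, 1:])"
      using alg_closed_imp_factorization[OF q0] by blast
    have "x = a" if "x \<in># A" for x
    proof -
      have "[:-x, 1:] dvd (\<Prod>x\<in>#A. [:-x, 1:])" using that by (intro dvd_prod_mset) auto
      then have "[:-x, 1:] dvd q" by (subst A(2)) (rule dvd_smult)
      then have "poly q x = 0" by (simp add: poly_eq_0_iff_dvd)
      then show ?thesis using unique[of "proj_point 1 x" "proj_point 1 a"] a root proj_point_eq_1_iff by metis
    qed
    then have "A = replicate_mset (size A) a" by (intro set_mset_subset_singletonD) auto
    then have "A = replicate_mset (ord2 f) a" using A(1) deg by simp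
    then have "(\<Prod>x\<in>#A. [:-x, 1:]) = [:-a, 1:] ^ ord2 f" by simp
    with A(2) have "graded f $ ord2 f = smult (lead_coeff q) ([:-a, 1:] ^ ord2 f)"
      unfolding q_def by metis
    moreover have "lead_coeff q \<noteq> 0" using q0 by simp
    ultimately show thesis by (rule finite_slope[rotated])
  qed
qed

lemma graded_smooth:
  fixes w :: "'k::field fps2"
  assumes "smooth_curve w"
  shows "graded w $ 1 = [:w $ 0 $ 1, w $ 1 $ 0:]" "graded w $ 1 \<noteq> 0"
proof -
  show "graded w $ 1 = [:w $ 0 $ 1, w $ 1 $ 0:]"
    by (rule poly_eqI) (auto simp: coeff_graded coeff_pCons split: nat.splits)
  have "ord2 w = 1" "w \<noteq> 0" using assms by (auto simp: smooth_curve_iff_ord2)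
  then show "graded w $ 1 \<noteq> 0"
    using nth_subdegree_nonzero[of "graded w"] by (simp add: ord2_eq_subdegree graded_eq_0_iff)
qed

lemma tangent_to_finite_slope:
  fixes f w :: "'k::field fps2"
  assumes "tangent_to w f" "graded f $ ord2 f = smult c ([:- a, 1:] ^ ord2 f)" "ord2 f > 0"
  shows "\<exists>c. c \<noteq> 0 \<and> graded w $ ord2 w = smult c ([:- a, 1:] ^ ord2 w)"
proof -
  have w: "smooth_curve w" "tangent_cone w = tangent_cone f" using assms(1) by (auto simp: tangent_to_def)
  have o: "ord2 w = 1" using w(1) by (simp add: smooth_curve_iff_ord2)
  have "poly (graded f $ ord2 f) a = 0" using assms(2,3) by simp
  then have "proj_point 1 a \<in> tangent_cone w"
    by (simp add: w(2) proj_point_mem_tangent_cone initial_form_at_1)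
  then have "poly (graded w $ ord2 w) a = 0"
    by (simp add: proj_point_mem_tangent_cone initial_form_at_1)
  then have root: "w $ 0 $ 1 = - (a * w $ 1 $ 0)"
    unfolding o graded_smooth(1)[OF w(1)] by (simp add: eq_neg_iff_add_eq_0)
  moreover have "w $ 1 $ 0 \<noteq> 0" using graded_smooth[OF w(1)] root by auto
  ultimately show ?thesis
    unfolding o graded_smooth(1)[OF w(1)] by (intro exI[of _ "w $ 1 $ 0"]) simp
qed

lemma tangent_to_vertical:
  fixes f w :: "'k::field fps2"
  assumes "tangent_to w f" "graded f $ ord2 f = [:c:]" "ord2 f > 0"
  shows "\<exists>c. c \<noteq> 0 \<and> graded w $ ord2 w = [:c:]"
proof -
  have w: "smooth_curve w" "tangent_cone w = tangent_cone f" using assms(1) by (auto simp: tangent_to_def)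
  have o: "ord2 w = 1" using w(1) by (simp add: smooth_curve_iff_ord2)
  have "coeff (graded f $ ord2 f) (ord2 f) = 0" using assms(2,3) by (simp add: coeff_pCons split: nat.split)
  then have "proj_point 0 1 \<in> tangent_cone w"
    by (simp add: w(2) proj_point_mem_tangent_cone initial_form_at_0_1)
  then have "coeff (graded w $ ord2 w) (ord2 w) = 0"
    by (simp add: proj_point_mem_tangent_cone initial_form_at_0_1)
  then have "w $ 1 $ 0 = 0" unfolding o graded_smooth(1)[OF w(1)] by simp
  then show ?thesis using graded_smooth[OF w(1)] unfolding o by auto
qed

text \<open>
  The automorphism $\<sigma>$ makes the tangent of $f$ horizontal. A shear does not affect the
  quadratic transform, so $\<tau>$ is the identity in this case. If the tangent of $f$ is vertical,
  then the variables are exchanged before and after the transform.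
\<close>

lemma transform_in_coordinates:
  fixes f :: "'k::alg_closed_field fps2"
  assumes "unitangent f" "f \<noteq> 0" "ord2 f > 0"
  obtains \<sigma> \<sigma>' \<tau> \<tau>' where "K_automorphism \<sigma> \<sigma>'" "K_automorphism \<tau> \<tau>'"
    "horizontal (ord2 f) (\<sigma> f)" "strict_transform f = \<tau> (transform (ord2 f) (\<sigma> f))"
    "\<And>w. tangent_to w f \<Longrightarrow> horizontal 1 (\<sigma> w)"
    "\<And>w. tangent_to w f \<Longrightarrow> strict_transform w = \<tau> (transform 1 (\<sigma> w))"
  using assms
proof (cases rule: unitangent_cases)
  case (finite_slope a c)
  have id: "K_automorphism (\<lambda>f. f) (\<lambda>f. f)" by standard simp_all
  have w: "horizontal 1 (shear a w) \<and> strict_transform w = transform 1 (shear a w)"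
    if t: "tangent_to w f" for w
  proof -
    have o: "ord2 w = 1" using t by (simp add: tangent_to_def smooth_curve_iff_ord2)
    obtain d where d: "d \<noteq> 0" "graded w $ ord2 w = smult d ([:- a, 1:] ^ ord2 w)"
      using tangent_to_finite_slope[OF t finite_slope(2) assms(3)] by blast
    show ?thesis
      using horizontal_shear[OF d(2,1)] strict_transform_shear[OF d(2,1)] by (simp only: o)
  qed
  show thesis
    by (rule that[OF K_automorphism_shear id, of a])
      (use horizontal_shear[OF finite_slope(2,1)] strict_transform_shear[OF finite_slope(2,1) assms(3)]
        w in auto)
next
  case (vertical c)
  have w: "horizontal 1 (swap w) \<and> strict_transform w = swap (transform 1 (swap w))"
    if t: "tangent_to w f" for w
  proof -
    have o: "ord2 w = 1" using t by (simp add: tangent_to_def smooth_curve_iff_ord2)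
    obtain d where d: "d \<noteq> 0" "graded w $ ord2 w = [:d:]"
      using tangent_to_vertical[OF t vertical(2) assms(3)] by blast
    show ?thesis
      using horizontal_swap[OF d(2,1)] strict_transform_swap[OF d(2,1)] by (simp only: o)
  qed
  show thesis
    by (rule that[OF K_automorphism_swap K_automorphism_swap])
      (use horizontal_swap[OF vertical(2,1)] strict_transform_swap[OF vertical(2,1) assms(3)]
        w in auto)
qed

section \<open>The quadratic transform of a unitangent curve\<close>

theorem theorem3p7:
  fixes f :: "'k::alg_closed_field fps2"
  assumes "reduced_curve f" and "singular_curve f" and "unitangent f"
  shows "(contact_exponent f < 2 \<longrightarrow> curve_mult (strict_transform f) < curve_mult f) \<and>
    (contact_exponent f \<ge> 2 \<longrightarrow>
       curve_mult (strict_transform f) = curve_mult f \<and>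
       contact_exponent (strict_transform f) = contact_exponent f - 1) \<and>
    (contact_exponent f \<ge> 2 \<longrightarrow>
       (\<forall>w. smooth_curve w \<and> tangent_to w f \<longrightarrow>
          contact f w = contact (strict_transform f) (strict_transform w) + 1 \<and>
          (maximal_contact w f \<longrightarrow>
             maximal_contact (strict_transform w) (strict_transform f))))"
proof -
  define n where "n = ord2 f"
  have f: "f \<noteq> 0" "ord2 f > 0"
    using assms(2) by (auto simp: singular_curve_def algebroid_curve_iff_ord2)
  obtain \<sigma> \<sigma>' \<tau> \<tau>' where \<sigma>: "K_automorphism \<sigma> \<sigma>'" and \<tau>: "K_automorphism \<tau> \<tau>'"
    and hf: "horizontal n (\<sigma> f)" and Tf: "strict_transform f = \<tau> (transform n (\<sigma> f))"
    and hw: "\<And>w. tangent_to w f \<Longrightarrow> horizontal 1 (\<sigma> w)"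
    and Tw: "\<And>w. tangent_to w f \<Longrightarrow> strict_transform w = \<tau> (transform 1 (\<sigma> w))"
    unfolding n_def using transform_in_coordinates[OF assms(3) f] by blast
  interpret \<sigma>: K_automorphism \<sigma> \<sigma>' by (rule \<sigma>)
  interpret \<tau>: K_automorphism \<tau> \<tau>' by (rule \<tau>)
  have n: "n > 0" using f(2) by (simp add: n_def)
  note main = horizontal_quadratic_transform[OF hf n, unfolded \<sigma>.contact_exponent]
  show ?thesis
  proof (intro conjI impI allI)
    assume "contact_exponent f < 2"
    then show "curve_mult (strict_transform f) < curve_mult f"
      using main(1) by (simp add: Tf curve_mult_def \<tau>.ord2 n_def)
  next
    assume ge: "2 \<le> contact_exponent f"
    show "curve_mult (strict_transform f) = curve_mult f"
      using main(2)[OF ge] by (simp add: Tf curve_mult_def \<tau>.ord2 n_def)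
    show "contact_exponent (strict_transform f) = contact_exponent f - 1"
      using main(3)[OF ge] by (simp add: Tf \<tau>.contact_exponent)
  next
    fix w assume ge: "2 \<le> contact_exponent f" and "smooth_curve w \<and> tangent_to w f"
    then have t: "tangent_to w f" by simp
    show "contact f w = contact (strict_transform f) (strict_transform w) + 1"
      using main(4)[OF ge hw[OF t]] unfolding Tf Tw[OF t] \<sigma>.contact \<tau>.contact .
    show "maximal_contact (strict_transform w) (strict_transform f)" if "maximal_contact w f"
      using main(5)[OF ge hw[OF t]] that
      unfolding Tf Tw[OF t] \<sigma>.maximal_contact_iff \<tau>.maximal_contact_iff by blast
  qed
qed

end
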